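(* Let $\kappa$ be an infinite cardinal with $\kappa^{\omega}=\kappa$, let $\lambda=\kappa^{+n}$ for some $n<\omega$, and assume that $\Box_\nu$ holds for each cardinal $\nu$ with $\kappa\le\nu<\lambda$. Then there is a $\kappa$-homogeneous, but not $\kappa$-transitive permutation group on $\lambda$.
   Context: $\kappa^{+n}$ is the $n$-th cardinal successor of $\kappa$ (with $\kappa^{+0}=\kappa$), and $\Box_\nu$ denotes Jensen's square principle at $\nu$. A permutation group on a set $A$ is a subgroup of the group $S(A)$ of all permutations of $A$. For a cardinal $\kappa$, $[A]^{\kappa}$ (resp. $[A]^{\le\kappa}$) is the set of subsets of $A$ of cardinality $\kappa$ (resp. at most $\kappa$). Functions are identified with their graphs. A permutation group $G$ on $A$ is $\kappa$-homogeneous iff for all $X,Y\in[A]^{\kappa}$ with $|A\setminus X|=|A\setminus Y|=|A|$ there is $g\in G$ with $g[X]=Y$. A permutation group $G$ on $A$ is $\kappa$-transitive iff for any injective function $f$ with $\operatorname{dom}(f)\cup\operatorname{ran}(f)\in[A]^{\le\kappa}$ and $|A\setminus\operatorname{dom}(f)|=|A\setminus\operatorname{ran}(f)|=|A|$ there is $g\in G$ with $f\subseteq g$. *)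

theory Defs
  imports "HOL-Algebra.Bij"
begin

unbundle cardinal_syntax

text \<open>
  As in HOL's cardinal library, a cardinal is a relation \<open>r\<close> with \<^term>\<open>Card_order r\<close>, i.e. a
  well-order of minimal order type on its field, and \<open>=o\<close>, \<open>\<le>o\<close>, \<open><o\<close> compare the order types
  of well-orders, possibly on different types.  The elements of the field of a well-order \<open>W\<close>
  stand for the ordinals below its order type, and \<^term>\<open>underS W a\<close> for the ordinal \<open>a\<close> itself.
\<close>

section \<open>Iterated cardinal successors\<close>

text \<open>
  \<^term>\<open>cardSuc\<close> changes the carrier type, so it cannot be iterated a variable number of times.
  Instead \<open>is_nth_cardSuc n \<kappa> lam\<close> says that \<open>lam\<close> is (up to order isomorphism) the \<open>n\<close>-th
  cardinal successor of \<open>\<kappa>\<close>.  Taking the intermediate successors on the carrier type of \<open>lam\<close>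
  loses nothing: they are smaller than \<open>lam\<close>, hence isomorphic to cardinals on that type.
\<close>

primrec is_nth_cardSuc :: "nat \<Rightarrow> 'k rel \<Rightarrow> 'a rel \<Rightarrow> bool" where
  "is_nth_cardSuc 0 \<kappa> lam \<longleftrightarrow> lam =o \<kappa>"
| "is_nth_cardSuc (Suc n) \<kappa> lam \<longleftrightarrow> (\<exists>\<mu>::'a rel. is_nth_cardSuc n \<kappa> \<mu> \<and> lam =o cardSuc \<mu>)"

section \<open>Jensen's square principle\<close>

definition otp :: "'a rel \<Rightarrow> 'a set \<Rightarrow> 'a rel" where
  "otp W X = Restr W X"

text \<open>
  Library cofinality is strict (every element of the order has a strictly larger one in the set).
  Together with \<open>underS W a \<noteq> {}\<close>, \<open>unbounded_in\<close> therefore forces \<open>a\<close> to be a limit ordinal.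
\<close>

definition unbounded_in :: "'a rel \<Rightarrow> 'a \<Rightarrow> 'a set \<Rightarrow> bool" where
  "unbounded_in W a X \<longleftrightarrow> cofinal (X \<inter> underS W a) (otp W (underS W a))"

definition limit_ordinal :: "'a rel \<Rightarrow> 'a \<Rightarrow> bool" where
  "limit_ordinal W a \<longleftrightarrow> a \<in> Field W \<and> underS W a \<noteq> {} \<and> unbounded_in W a (underS W a)"

definition limit_point :: "'a rel \<Rightarrow> 'a set \<Rightarrow> 'a \<Rightarrow> bool" where
  "limit_point W X b \<longleftrightarrow> limit_ordinal W b \<and> unbounded_in W b X"

definition club_in :: "'a rel \<Rightarrow> 'a \<Rightarrow> 'a set \<Rightarrow> bool" where
  "club_in W a X \<longleftrightarrow> X \<subseteq> underS W a \<and> unbounded_in W a X \<and>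
     (\<forall>b \<in> underS W a. limit_point W X b \<longrightarrow> b \<in> X)"

text \<open>The cofinality of a limit ordinal, as a cardinal.\<close>

definition cf :: "'a rel \<Rightarrow> 'a \<Rightarrow> 'a rel" where
  "cf W a = |SOME X. X \<subseteq> underS W a \<and> unbounded_in W a X \<and>
     (\<forall>Y. Y \<subseteq> underS W a \<and> unbounded_in W a Y \<longrightarrow> |X| \<le>o |Y| )|"

text \<open>
  Jensen's original form of the principle: the order type is restricted only at ordinals of
  cofinality below \<open>\<nu>\<close>; for uncountable \<open>\<nu>\<close>, order type at most \<open>\<nu>\<close> everywhere follows by coherence.
\<close>

definition jensen_square :: "'a rel \<Rightarrow> bool" where
  "jensen_square \<nu> \<longleftrightarrow>
     (let W = cardSuc \<nu> in
      \<exists>C :: 'a set \<Rightarrow> 'a set set. \<forall>a. limit_ordinal W a \<longrightarrow>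
          club_in W a (C a) \<and>
          (cf W a <o \<nu> \<longrightarrow> otp W (C a) <o \<nu>) \<and>
          (\<forall>b \<in> underS W a. limit_point W (C a) b \<longrightarrow> C b = C a \<inter> underS W b))"

section \<open>Permutation groups\<close>

definition permutation_group_on :: "'a set \<Rightarrow> ('a \<Rightarrow> 'a) set \<Rightarrow> bool" where
  "permutation_group_on A G \<longleftrightarrow> subgroup G (BijGroup A)"

definition homogeneous_on :: "'k rel \<Rightarrow> 'a set \<Rightarrow> ('a \<Rightarrow> 'a) set \<Rightarrow> bool" where
  "homogeneous_on \<kappa> A G \<longleftrightarrow>
     (\<forall>X Y. X \<subseteq> A \<and> |X| =o \<kappa> \<and> Y \<subseteq> A \<and> |Y| =o \<kappa> \<and> |A - X| =o |A| \<and> |A - Y| =o |A|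
        \<longrightarrow> (\<exists>g \<in> G. g ` X = Y))"

definition transitive_on :: "'k rel \<Rightarrow> 'a set \<Rightarrow> ('a \<Rightarrow> 'a) set \<Rightarrow> bool" where
  "transitive_on \<kappa> A G \<longleftrightarrow>
     (\<forall>f :: 'a \<rightharpoonup> 'a. inj_on f (dom f) \<and> dom f \<union> ran f \<subseteq> A \<and> |dom f \<union> ran f| \<le>o \<kappa> \<and>
          |A - dom f| =o |A| \<and> |A - ran f| =o |A|
        \<longrightarrow> (\<exists>g \<in> G. f \<subseteq>\<^sub>m (\<lambda>x. Some (g x))))"

end

theory Submission
  imports Defs "HOL-Library.Nat_Bijection"
begin

text \<open>
  Call a family of filtrations \<open>F\<close> (increasing \<open>\<kappa>\<close>-sequences of sets of size below \<open>\<kappa>\<close>) coherent if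
  any two of them agree from some index on, up to intersection with their unions.  The union of
  \<open>F\<close>, if it has size \<open>\<kappa>\<close>, is well-ordered in type \<open>\<kappa>\<close> by first comparing the index at which a
  point appears, and by coherence the orders of two filtrations agree off a set of size below \<open>\<kappa>\<close>.
  Hence the permutations that are piecewise monotone for these orders, with finitely many
  pieces and fewer than \<open>\<kappa>\<close> exceptional points, form a group.  If the unions are cofinal in the
  subsets of size at most \<open>\<kappa>\<close>, the group is \<open>\<kappa>\<close>-homogeneous, because two subsets of order type
  \<open>\<kappa>\<close> are matched by an increasing map.  It is not \<open>\<kappa>\<close>-transitive: a map that reverses \<open>\<kappa>\<close> many
  blocks of every finite size is not piecewise monotone.

  A cofinal coherent family is lifted from \<open>\<nu>\<close> to \<open>\<nu>\<^sup>+\<close> along Todorcevic's walks on a square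
  sequence.  The walk from \<open>a\<close> to \<open>x < a\<close> gives a finite code of \<open>x\<close> over the alphabet \<open>\<nu>\<close>, and
  square makes the codes given by \<open>a\<close> and \<open>b\<close> differ by finitely many replacements of prefixes.
  The points whose letters all lie in \<open>F j\<close> then form the new filtrations; there are fewer than \<open>\<kappa>\<close>
  of them because \<open>\<kappa>\<^sup>\<omega> = \<kappa>\<close> implies \<open>\<omega> < \<kappa>\<close>.
\<close>

section \<open>Comparing elements of a well-order\<close>

context wo_rel
begin

lemma underS_le_trans: "x \<in> underS y \<Longrightarrow> (y, z) \<in> r \<Longrightarrow> x \<in> underS z"
  using TRANS ANTISYM unfolding underS_def trans_def antisym_def by blast

lemma le_underS_trans: "(x, y) \<in> r \<Longrightarrow> y \<in> underS z \<Longrightarrow> x \<in> underS z"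
  using TRANS ANTISYM unfolding underS_def trans_def antisym_def by blast

lemma underS_trans: "x \<in> underS y \<Longrightarrow> y \<in> underS z \<Longrightarrow> x \<in> underS z"
  using underS_le_trans by (blast dest: underS_E)

lemma underS_imp_Field: "x \<in> underS a \<Longrightarrow> x \<in> Field r \<and> a \<in> Field r"
  unfolding underS_def Field_def by blast

lemma not_le_iff_underS: "x \<in> Field r \<Longrightarrow> y \<in> Field r \<Longrightarrow> (x, y) \<notin> r \<longleftrightarrow> y \<in> underS x"
  using TOTAL REFL ANTISYM
  unfolding underS_def total_on_def refl_on_def antisym_def by auto metis

lemma underS_induct [consumes 1, case_names less]:
  assumes "a \<in> Field r"
    and "\<And>a. a \<in> Field r \<Longrightarrow> (\<And>b. b \<in> underS a \<Longrightarrow> P b) \<Longrightarrow> P a"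
  shows "P a"
proof -
  have "a \<in> Field r \<longrightarrow> P a"
  proof (induction a rule: wf_induct_rule[OF WF])
    case (1 a)
    show ?case
      using assms(2)[of a] 1 underS_imp_Field by (auto simp: underS_def)
  qed
  then show ?thesis
    using assms(1) by blast
qed

end

section \<open>Codes along walks\<close>

text \<open>Finiteness of \<open>P\<close>, uniformly in \<open>x\<close>, confines the disagreement
  of the two codes to finitely many letters, while the common tail \<open>w\<close> is
  arbitrary.\<close>

definition prefix_coherent :: "'b set \<Rightarrow> ('b \<Rightarrow> 'c list) \<Rightarrow> ('b \<Rightarrow> 'c list) \<Rightarrow> bool" where
  "prefix_coherent X f g \<longleftrightarrow>
     (\<exists>P. finite P \<and> (\<forall>x\<in>X. \<exists>u v w. (u, v) \<in> P \<and> f x = u @ w \<and> g x = v @ w))"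

lemma prefix_coherentI:
  assumes "finite P" and "\<And>x. x \<in> X \<Longrightarrow> \<exists>u v w. (u, v) \<in> P \<and> f x = u @ w \<and> g x = v @ w"
  shows "prefix_coherent X f g"
  using assms unfolding prefix_coherent_def by blast

lemma prefix_coherentE:
  assumes "prefix_coherent X f g"
  obtains P where "finite P"
    and "\<And>x. x \<in> X \<Longrightarrow> \<exists>u v w. (u, v) \<in> P \<and> f x = u @ w \<and> g x = v @ w"
proof -
  from assms obtain P where "finite P"
    "\<forall>x\<in>X. \<exists>u v w. (u, v) \<in> P \<and> f x = u @ w \<and> g x = v @ w"
    unfolding prefix_coherent_def by blast
  then show ?thesis
    using that by blast
qed

lemma prefix_coherent_refl: "prefix_coherent X f f"
  by (rule prefix_coherentI[of "{([], [])}"]) auto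

lemma prefix_coherent_cong:
  assumes "prefix_coherent X f g" and "\<And>x. x \<in> X \<Longrightarrow> f x = f' x" and "\<And>x. x \<in> X \<Longrightarrow> g x = g' x"
  shows "prefix_coherent X f' g'"
  using assms unfolding prefix_coherent_def by simp

lemma prefix_coherent_sym: "prefix_coherent X f g \<Longrightarrow> prefix_coherent X g f"
  by (erule prefix_coherentE, rule prefix_coherentI[OF finite_converse[THEN iffD2]]) blast+

lemma prefix_coherent_subset: "prefix_coherent X f g \<Longrightarrow> Y \<subseteq> X \<Longrightarrow> prefix_coherent Y f g"
  unfolding prefix_coherent_def by (meson subsetD)

lemma prefix_coherent_Un:
  assumes "prefix_coherent X f g" and "prefix_coherent Y f g"
  shows "prefix_coherent (X \<union> Y) f g"
proof -
  obtain P Q where "finite P" "\<forall>x\<in>X. \<exists>u v w. (u, v) \<in> P \<and> f x = u @ w \<and> g x = v @ w"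
    "finite Q" "\<forall>x\<in>Y. \<exists>u v w. (u, v) \<in> Q \<and> f x = u @ w \<and> g x = v @ w"
    using assms unfolding prefix_coherent_def by blast
  then show ?thesis
    by (intro prefix_coherentI[of "P \<union> Q"]) (blast | simp)+
qed

lemma prefix_coherent_singleton: "prefix_coherent {x} f g"
  by (rule prefix_coherentI[of "{(f x, g x)}"]) auto

lemma prefix_coherent_Cons:
  assumes "prefix_coherent X f g"
  shows "prefix_coherent X (\<lambda>x. a # f x) g"
proof -
  obtain P where P: "finite P" "\<forall>x\<in>X. \<exists>u v w. (u, v) \<in> P \<and> f x = u @ w \<and> g x = v @ w"
    using assms unfolding prefix_coherent_def by blast
  show ?thesis
  proof (rule prefix_coherentI)
    show "finite ((\<lambda>(u, v). (a # u, v)) ` P)"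
      using P by simp
    fix x assume "x \<in> X"
    then obtain u v w where "(u, v) \<in> P" "f x = u @ w" "g x = v @ w"
      using P by blast
    then show "\<exists>u v w. (u, v) \<in> (\<lambda>(u, v). (a # u, v)) ` P \<and> a # f x = u @ w \<and> g x = v @ w"
      by (intro exI[of _ "a # u"] exI[of _ v] exI[of _ w]) force
  qed
qed

text \<open>The middle word factors as \<open>v @ w\<close> and as \<open>v' @ w'\<close>, so one of
  \<open>v\<close>, \<open>v'\<close> is a prefix of the other. The excess is appended to the
  partner of the shorter one.\<close>

lemma prefix_coherent_trans:
  assumes "prefix_coherent X f g" and "prefix_coherent X g h"
  shows "prefix_coherent X f h"
proof -
  obtain P Q where P: "finite P" "\<forall>x\<in>X. \<exists>u v w. (u, v) \<in> P \<and> f x = u @ w \<and> g x = v @ w"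
    and Q: "finite Q" "\<forall>x\<in>X. \<exists>u v w. (u, v) \<in> Q \<and> g x = u @ w \<and> h x = v @ w"
    using assms unfolding prefix_coherent_def by blast
  \<comment> \<open>Each \<open>drop\<close> returns the excess, or \<open>[]\<close> on the side
    that has none, so one formula covers both cases.\<close>
  define c where "c = (\<lambda>((u :: 'b list, v :: 'b list), (v' :: 'b list, t :: 'b list)).
    (u @ drop (length v) v', t @ drop (length v') v))"
  show ?thesis
  proof (rule prefix_coherentI)
    show "finite (c ` (P \<times> Q))"
      using P Q by simp
  next
    fix x assume "x \<in> X"
    obtain u v w where 1: "(u, v) \<in> P" "f x = u @ w" "g x = v @ w"
      using P(2) \<open>x \<in> X\<close> by blast
    obtain v' t w' where 2: "(v', t) \<in> Q" "g x = v' @ w'" "h x = t @ w'"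
      using Q(2) \<open>x \<in> X\<close> by blast
    have "v @ w = v' @ w'"
      using 1 2 by simp
    then obtain d where "v = v' @ d \<and> d @ w = w' \<or> v @ d = v' \<and> w = d @ w'"
      by (auto simp: append_eq_append_conv2)
    then have "\<exists>z. f x = (u @ drop (length v) v') @ z \<and> h x = (t @ drop (length v') v) @ z"
      using 1 2 by auto
    moreover have "c ((u, v), (v', t)) \<in> c ` (P \<times> Q)"
      using 1 2 by (intro imageI) simp
    then have "(u @ drop (length v) v', t @ drop (length v') v) \<in> c ` (P \<times> Q)"
      by (simp only: c_def prod.case)
    ultimately show "\<exists>u v w. (u, v) \<in> c ` (P \<times> Q) \<and> f x = u @ w \<and> h x = v @ w"
      by blast
  qed
qed

text \<open>This isolates what walks need from square. The bound in \<open>D_cofinal\<close> is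
  weak, so that the predecessor alone can serve as the ladder of a successor ordinal. The long
  premise of the two coherence assumptions says that \<open>b\<close> is an accumulation point of
  \<open>D a\<close>, which is where square gives information.\<close>

locale walk =
  fixes W :: "'b rel" and D :: "'b \<Rightarrow> 'b set" and l :: "'b \<Rightarrow> 'b \<Rightarrow> 'c"
  assumes Well_order: "Well_order W"
    and D_subset: "a \<in> Field W \<Longrightarrow> D a \<subseteq> underS W a"
    and D_cofinal: "a \<in> Field W \<Longrightarrow> x \<in> underS W a \<Longrightarrow> \<exists>c\<in>D a. (x, c) \<in> W"
    and inj_label: "a \<in> Field W \<Longrightarrow> inj_on (l a) (D a)"
    and D_coherent: "\<lbrakk>a \<in> Field W; b \<in> underS W a; underS W b \<noteq> {};
        \<And>x. x \<in> underS W b \<Longrightarrow> \<exists>c\<in>D a \<inter> underS W b. x \<in> underS W c\<rbrakk>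
      \<Longrightarrow> D b = D a \<inter> underS W b"
    and label_coherent: "\<lbrakk>a \<in> Field W; b \<in> underS W a; underS W b \<noteq> {};
        \<And>x. x \<in> underS W b \<Longrightarrow> \<exists>c\<in>D a \<inter> underS W b. x \<in> underS W c; c \<in> D b\<rbrakk>
      \<Longrightarrow> l b c = l a c"
begin

sublocale wo: wo_rel W
  using Well_order by (simp add: wo_rel_def)

definition step :: "'b \<Rightarrow> 'b \<Rightarrow> 'b" where
  "step a x = wo.minim {c \<in> D a. (x, c) \<in> W}"

text \<open>The labels along the walk from \<open>a\<close> down to \<open>x\<close>, i.e. Todorcevic's full code.\<close>

definition code :: "'b \<Rightarrow> 'b \<Rightarrow> 'c list" where
  "code = wfrec (W - Id)
     (\<lambda>f a x. l a (step a x) # (if step a x = x then [] else f (step a x) x))"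

lemma step:
  assumes "x \<in> underS W a"
  shows "step a x \<in> D a" and "(x, step a x) \<in> W" and "step a x \<in> underS W a"
    and "c \<in> D a \<Longrightarrow> (x, c) \<in> W \<Longrightarrow> (step a x, c) \<in> W"
proof -
  let ?A = "{c \<in> D a. (x, c) \<in> W}"
  have A: "?A \<subseteq> Field W" "?A \<noteq> {}"
    using D_cofinal[OF _ assms] wo.underS_imp_Field[OF assms] by (auto intro: FieldI2)
  have "step a x \<in> ?A"
    unfolding step_def using wo.minim_in[OF A] .
  then show "step a x \<in> D a" "(x, step a x) \<in> W" "step a x \<in> underS W a"
    using D_subset wo.underS_imp_Field assms by auto
  show "c \<in> D a \<Longrightarrow> (x, c) \<in> W \<Longrightarrow> (step a x, c) \<in> W"
    unfolding step_def using wo.minim_least[OF A(1)] by blast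
qed

lemma step_eqI:
  assumes "x \<in> underS W a" "c \<in> D a" "(x, c) \<in> W" "\<And>d. d \<in> D a \<Longrightarrow> (x, d) \<in> W \<Longrightarrow> (c, d) \<in> W"
  shows "step a x = c"
  using step[OF assms(1)] assms(2-) wo.ANTISYM unfolding antisym_def by blast

lemma code:
  assumes "x \<in> underS W a"
  shows "code a x = l a (step a x) # (if step a x = x then [] else code (step a x) x)"
proof -
  have "(step a x, a) \<in> W - Id"
    using step(3)[OF assms] by (auto simp: underS_def)
  then show ?thesis
    unfolding code_def by (subst wfrec[OF wo.WF]) (simp add: cut_apply)
qed

lemma step_neq: "x \<in> underS W a \<Longrightarrow> step a x \<noteq> x \<Longrightarrow> x \<in> underS W (step a x)"
  using step(2) by (auto simp: underS_def)

lemma code_in_lists: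
  assumes "\<And>a. a \<in> Field W \<Longrightarrow> l a ` D a \<subseteq> L" and "a \<in> Field W" and "x \<in> underS W a"
  shows "set (code a x) \<subseteq> L"
  using assms(2,3)
proof (induction a rule: wo.underS_induct)
  case (less a)
  have "l a (step a x) \<in> L"
    using assms(1)[OF less.hyps] step(1)[OF less.prems] by blast
  moreover have "set (code (step a x) x) \<subseteq> L" if "step a x \<noteq> x"
    using less.IH[OF step(3)] step_neq that less.prems by blast
  ultimately show ?case
    using code[OF less.prems] by simp
qed

text \<open>The walk can be read off its code: the first label fixes the first step because
  \<open>l a\<close> is injective on \<open>D a\<close>, and the rest follows by induction. A walk
  that ends after one step has an empty tail and one that goes on does not, so the two are never
  confused.\<close>

lemma inj_on_code:
  assumes "a \<in> Field W"
  shows "inj_on (code a) (underS W a)"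
  using assms
proof (induction a rule: wo.underS_induct)
  case (less a)
  show ?case
  proof (rule inj_onI)
    fix x y assume xy: "x \<in> underS W a" "y \<in> underS W a" "code a x = code a y"
    have eq: "step a x = step a y"
      using xy code[OF xy(1)] code[OF xy(2)] inj_onD[OF inj_label[OF less.hyps]]
        step(1)[OF xy(1)] step(1)[OF xy(2)] by auto
    have ne: "code (step a z) z \<noteq> []" if "z \<in> underS W a" "step a z \<noteq> z" for z
      using code step_neq[OF that] by simp
    show "x = y"
    proof (cases "step a x = x \<or> step a y = y")
      case True
      then show ?thesis
        using xy(3) code[OF xy(1)] code[OF xy(2)] eq ne[OF xy(1)] ne[OF xy(2)]
        by (auto split: if_splits)
    next
      case False
      then have "code (step a x) x = code (step a x) y"
        using xy(3) code[OF xy(1)] code[OF xy(2)] eq by auto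
      then show ?thesis
        using less.IH[OF step(3)[OF xy(1)]] step_neq[OF xy(1)] step_neq[OF xy(2)] False eq
        by (auto dest: inj_onD)
    qed
  qed
qed

text \<open>Nested induction, on \<open>a\<close> and then on \<open>b\<close>. If
  \<open>D a\<close> accumulates at \<open>b\<close>, the two codes coincide below \<open>b\<close>.
  Otherwise the part of \<open>D a\<close> below \<open>b\<close> has a supremum \<open>g\<close>
  less than \<open>b\<close>, and the points below \<open>g\<close>, \<open>g\<close> itself and the
  points above \<open>g\<close> are treated separately.\<close>

lemma code_coherent_less:
  assumes "a \<in> Field W" and "b \<in> underS W a"
  shows "prefix_coherent (underS W b) (code a) (code b)"
  using assms
proof (induction a arbitrary: b rule: wo.underS_induct)
  case (less a)
  have "b \<in> Field W"
    using less.prems wo.underS_imp_Field by blast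
  then show ?case
    using less.prems
  proof (induction b rule: wo.underS_induct)
    case inner: (less b)
    let ?B = "D a \<inter> underS W b"
    show ?case
    proof (cases "\<forall>x\<in>underS W b. \<exists>c\<in>?B. x \<in> underS W c")
      case True
      have "code a x = code b x" if x: "x \<in> underS W b" for x
      proof -
        have ne: "underS W b \<noteq> {}"
          using x by blast
        note coh = D_coherent[OF less.hyps inner.prems ne, OF bspec[OF True]]
        have xa: "x \<in> underS W a"
          using x inner.prems wo.underS_le_trans unfolding underS_def by blast
        \<comment> \<open>\<open>D b\<close> is the part of \<open>D a\<close> below
          \<open>b\<close>, and it already has a point at or above \<open>x\<close>, so ladder
          points of \<open>a\<close> from \<open>b\<close> upwards do not interfere.\<close>
        have "step a x = step b x"
        proof (rule step_eqI[OF xa])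
          show "step b x \<in> D a" "(x, step b x) \<in> W"
            using step[OF x] coh by auto
          fix d assume d: "d \<in> D a" "(x, d) \<in> W"
          show "(step b x, d) \<in> W"
          proof (cases "d \<in> underS W b")
            case True
            then show ?thesis
              using step(4)[OF x] d coh by blast
          next
            case False
            then have "(b, d) \<in> W"
              using wo.not_le_iff_underS[of b d] inner.hyps d by (auto simp: Field_def)
            then show ?thesis
              using wo.underS_le_trans[OF step(3)[OF x]] by (auto simp: underS_def)
          qed
        qed
        moreover have "l b (step b x) = l a (step b x)"
          using label_coherent[OF less.hyps inner.prems ne, OF bspec[OF True]] step(1)[OF x]
          by blast
        ultimately show ?thesis
          using code[OF x] code[OF xa] by simp
      qed
      then show ?thesis
        using prefix_coherent_cong[OF prefix_coherent_refl] by metis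
    next
      case False
      then obtain y where y: "y \<in> underS W b" "\<And>c. c \<in> ?B \<Longrightarrow> (c, y) \<in> W"
        using wo.not_le_iff_underS wo.underS_imp_Field by blast
      \<comment> \<open>\<open>g\<close> is the supremum of \<open>?B\<close>, or the least element
        of the order if \<open>?B\<close> is empty. No point of \<open>D a\<close> lies strictly
        between \<open>g\<close> and \<open>b\<close>.\<close>
      let ?U = "{z \<in> Field W. \<forall>c\<in>?B. (c, z) \<in> W}"
      define g where "g = wo.minim ?U"
      have U: "?U \<subseteq> Field W" "?U \<noteq> {}"
        using y wo.underS_imp_Field by blast+
      have g_in: "\<And>c. c \<in> ?B \<Longrightarrow> (c, g) \<in> W" and g_least: "\<And>z. z \<in> ?U \<Longrightarrow> (g, z) \<in> W"
        unfolding g_def using wo.minim_in[OF U] wo.minim_least[OF U(1)] by blast+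
      have gb: "g \<in> underS W b"
        using g_least y wo.underS_imp_Field wo.le_underS_trans by blast
      then have ga: "g \<in> underS W a"
        using inner.prems wo.underS_le_trans unfolding underS_def by blast
      \<comment> \<open>The inner hypothesis compares \<open>a\<close> with \<open>g\<close>, and
        the outer one compares \<open>b\<close> with \<open>g\<close>.\<close>
      have "prefix_coherent (underS W g) (code a) (code g)"
        using inner.IH[OF gb ga] .
      moreover have "prefix_coherent (underS W g) (code g) (code b)"
        using less.IH[OF inner.prems gb] prefix_coherent_sym by blast
      ultimately have low: "prefix_coherent (underS W g) (code a) (code b)"
        using prefix_coherent_trans by blast
      define c where "c = step a b"
      have c: "c \<in> D a" "(b, c) \<in> W" "c \<in> underS W a"
        unfolding c_def using step[OF inner.prems] by auto
      \<comment> \<open>All walks from \<open>a\<close> to points strictly between \<open>g\<close>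
        and \<open>b\<close> begin with the same step to \<open>c\<close>, the first ladder point at
        or above \<open>b\<close>. They contribute one fixed letter, after which the outer
        hypothesis compares \<open>c\<close> with \<open>b\<close>, unless the two are
        equal.\<close>
      have high_code: "code a x = l a c # code c x" if x: "x \<in> underS W b" "g \<in> underS W x" for x
      proof -
        have xa: "x \<in> underS W a"
          using x inner.prems wo.underS_le_trans unfolding underS_def by blast
        have "x \<in> underS W c"
          using x c wo.underS_le_trans by blast
        moreover have "step a x = c"
        proof (rule step_eqI[OF xa c(1)])
          show "(x, c) \<in> W"
            using \<open>x \<in> underS W c\<close> by (auto simp: underS_def)
          fix d assume d: "d \<in> D a" "(x, d) \<in> W"
          have "d \<notin> underS W b"
            using g_in[of d] d x(2) wo.underS_le_trans[OF x(2) d(2)] wo.ANTISYM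
            unfolding underS_def antisym_def by blast
          then have "(b, d) \<in> W"
            using wo.not_le_iff_underS[of b d] inner.hyps d by (auto simp: Field_def)
          then show "(c, d) \<in> W"
            unfolding c_def using step(4)[OF inner.prems d(1)] by blast
        qed
        ultimately show ?thesis
          using code[OF xa] by (auto simp: underS_def)
      qed
      have "prefix_coherent (underS W b) (code c) (code b)"
        using less.IH[OF c(3), of b] c(2) prefix_coherent_refl by (cases "b = c") (auto simp: underS_def)
      from prefix_coherent_Cons[OF this, of "l a c"]
      have "prefix_coherent {x \<in> underS W b. g \<in> underS W x} (\<lambda>x. l a c # code c x) (code b)"
        by (rule prefix_coherent_subset) blast
      then have high: "prefix_coherent {x \<in> underS W b. g \<in> underS W x} (code a) (code b)"
        by (rule prefix_coherent_cong) (simp_all add: high_code)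
      have "underS W b \<subseteq> underS W g \<union> {g} \<union> {x \<in> underS W b. g \<in> underS W x}"
        using wo.not_le_iff_underS[of g] gb wo.underS_imp_Field by (auto simp: underS_def)
      then show ?thesis
        using prefix_coherent_Un[OF prefix_coherent_Un[OF low prefix_coherent_singleton] high]
          prefix_coherent_subset by blast
    qed
  qed
qed

lemma code_coherent:
  assumes "a \<in> Field W" and "b \<in> Field W"
  shows "prefix_coherent (underS W a \<inter> underS W b) (code a) (code b)"
proof -
  consider "b \<in> underS W a" | "a = b" | "a \<in> underS W b"
    using wo.not_le_iff_underS[of a b] assms by (auto simp: underS_def)
  then show ?thesis
  proof cases
    case 1
    then show ?thesis
      using prefix_coherent_subset[OF code_coherent_less[OF assms(1)]] by blast
  next
    case 2
    then show ?thesis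
      by (simp add: prefix_coherent_refl)
  next
    case 3
    then show ?thesis
      using prefix_coherent_subset[OF prefix_coherent_sym[OF code_coherent_less[OF assms(2)]]]
      by blast
  qed
qed

end

section \<open>Walks on a square sequence\<close>

lemma Field_otp: "Well_order W \<Longrightarrow> X \<subseteq> Field W \<Longrightarrow> Field (otp W X) = X"
  unfolding otp_def order_on_defs by (simp add: Refl_Field_Restr2)

lemma Well_order_otp: "Well_order W \<Longrightarrow> Well_order (otp W X)"
  unfolding otp_def by (rule Well_order_Restr)

lemma unbounded_in_iff:
  assumes "Well_order W"
  shows "unbounded_in W a X \<longleftrightarrow> (\<forall>x\<in>underS W a. \<exists>c\<in>X \<inter> underS W a. x \<in> underS W c)"
proof -
  have "underS W a \<subseteq> Field W"
    by (auto simp: underS_def Field_def)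
  then show ?thesis
    unfolding unbounded_in_def cofinal_def Field_otp[OF assms \<open>underS W a \<subseteq> Field W\<close>]
    unfolding otp_def by (auto simp: underS_def)
qed

text \<open>The choice in \<open>cf\<close> is legitimate because every nonempty family of cardinals
  has a least member.\<close>

lemma cf_ordLeq:
  assumes "X \<subseteq> underS W a" and "unbounded_in W a X"
  shows "cf W a \<le>o |X|"
proof -
  define Q where "Q X \<longleftrightarrow> X \<subseteq> underS W a \<and> unbounded_in W a X" for X
  have "\<exists>r\<in>{|X| | X. Q X}. \<forall>r'\<in>{|X| | X. Q X}. r \<le>o r'"
    by (rule exists_minim_Well_order)
      (use assms card_of_Well_order in \<open>auto simp: Q_def\<close>)
  then have "\<exists>X. Q X \<and> (\<forall>Y. Q Y \<longrightarrow> |X| \<le>o |Y| )"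
    by blast
  from someI_ex[OF this[unfolded Q_def conj_assoc]] show ?thesis
    using assms unfolding cf_def by blast
qed

text \<open>Suprema of \<omega>-sequences thus fall under the order type clause of square, as \<nu>
  is uncountable.\<close>

lemma countable_cf_ordLess:
  fixes s :: "nat \<Rightarrow> 'a"
  assumes "natLeq <o \<nu>" and "range s \<subseteq> underS W a" and "unbounded_in W a (range s)"
  shows "cf W a <o \<nu>"
proof -
  have "cf W a \<le>o |range s|"
    using assms(2,3) by (rule cf_ordLeq)
  also have "|range s| \<le>o |UNIV :: nat set|"
    by (rule card_of_image)
  also have "|UNIV :: nat set| =o natLeq"
    by (rule card_of_nat)
  finally have "cf W a \<le>o natLeq" .
  then show ?thesis
    using assms(1) ordLeq_ordLess_trans by blast
qed

locale square =
  fixes \<nu> :: "'a rel" and C :: "'a set \<Rightarrow> 'a set set"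
  assumes Card_order: "Card_order \<nu>" and uncountable: "natLeq <o \<nu>"
    and club: "limit_ordinal (cardSuc \<nu>) a \<Longrightarrow> club_in (cardSuc \<nu>) a (C a)"
    and otp_small: "limit_ordinal (cardSuc \<nu>) a \<Longrightarrow> cf (cardSuc \<nu>) a <o \<nu> \<Longrightarrow>
      otp (cardSuc \<nu>) (C a) <o \<nu>"
    and coherent: "limit_ordinal (cardSuc \<nu>) a \<Longrightarrow> b \<in> underS (cardSuc \<nu>) a \<Longrightarrow>
      limit_point (cardSuc \<nu>) (C a) b \<Longrightarrow> C b = C a \<inter> underS (cardSuc \<nu>) b"
begin

abbreviation "W \<equiv> cardSuc \<nu>"

lemma Well_order_\<nu>: "Well_order \<nu>"
  using Card_order by (auto simp: card_order_on_def)

lemma Well_order_W: "Well_order W"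
  using Card_order by (rule cardSuc_Well_order)

sublocale wo: wo_rel W
  using Well_order_W by (simp add: wo_rel_def)

lemmas unbounded_iff = unbounded_in_iff[OF Well_order_W]

lemma club_subset: "limit_ordinal W a \<Longrightarrow> C a \<subseteq> underS W a"
  using club unfolding club_in_def by blast

lemma club_unbounded:
  "limit_ordinal W a \<Longrightarrow> x \<in> underS W a \<Longrightarrow> \<exists>c\<in>C a. x \<in> underS W c"
  using club unfolding club_in_def unbounded_iff by blast

lemma Field_otp_C: "limit_ordinal W a \<Longrightarrow> Field (otp W (C a)) = C a"
  using club_subset wo.underS_imp_Field by (intro Field_otp[OF Well_order_W]) blast

lemma limit_pointI:
  assumes "b \<in> Field W" "underS W b \<noteq> {}" "\<And>x. x \<in> underS W b \<Longrightarrow> \<exists>c\<in>X \<inter> underS W b. x \<in> underS W c"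
  shows "limit_point W X b"
  using assms unfolding limit_point_def limit_ordinal_def unbounded_iff by blast

text \<open>
  If the order type of \<open>C a\<close> exceeded \<open>\<nu>\<close>, then some \<open>b \<in> C a\<close> would have \<open>\<nu>\<close> predecessors in
  \<open>C a\<close>.  The supremum of an increasing \<open>\<omega>\<close>-sequence in \<open>C a\<close> above \<open>b\<close> is then an ordinal of
  cofinality \<open>\<omega> < \<nu>\<close> whose club, by coherence, has \<open>\<nu>\<close> elements.
\<close>

lemma otp_C_ordLeq:
  assumes a: "limit_ordinal W a"
  shows "otp W (C a) \<le>o \<nu>"
proof (rule ccontr)
  assume "\<not> otp W (C a) \<le>o \<nu>"
  then have less: "\<nu> <o otp W (C a)"
    using not_ordLeq_iff_ordLess[OF Well_order_\<nu> Well_order_otp[OF Well_order_W]] by blast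
  then obtain b where b: "b \<in> C a" "\<nu> =o Restr (otp W (C a)) (underS (otp W (C a)) b)"
    using ordLess_iff_ordIso_Restr[OF Well_order_otp[OF Well_order_W] Well_order_\<nu>] Field_otp_C[OF a] by metis
  have sub: "underS (otp W (C a)) b \<subseteq> C a \<inter> underS W b"
    by (auto simp: otp_def underS_def)
  \<comment> \<open>Stated for arbitrary \<open>Y\<close> because it is applied to
    \<open>C d\<close>, which is only known to contain the points of \<open>C a\<close> below
    \<open>b\<close>.\<close>
  have big: "\<not> otp W Y <o \<nu>" if Y: "C a \<inter> underS W b \<subseteq> Y" "Y \<subseteq> Field W" for Y
  proof
    assume "otp W Y <o \<nu>"
    have "\<nu> =o |Field \<nu>|"
      using Card_order card_of_Field_ordIso ordIso_symmetric by blast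
    also have "|Field \<nu>| =o |Field (Restr (otp W (C a)) (underS (otp W (C a)) b))|"
      using b(2) by (rule card_of_cong)
    also have "|Field (Restr (otp W (C a)) (underS (otp W (C a)) b))| \<le>o |Y|"
      by (rule card_of_mono1[OF subset_trans[OF Field_Restr_subset subset_trans[OF sub Y(1)]]])
    also have "|Y| \<le>o otp W Y"
      using card_of_least[of Y "otp W Y"] Field_otp[OF Well_order_W Y(2)]
        Well_order_otp[OF Well_order_W] by metis
    also have "otp W Y <o \<nu>" by fact
    finally show False
      using ordLess_irreflexive by blast
  qed
  have "\<exists>s :: nat \<Rightarrow> 'a set. s 0 = b \<and> (\<forall>n. s n \<in> C a \<and> s n \<in> underS W (s (Suc n)))"
  proof -
    have "\<exists>s :: nat \<Rightarrow> 'a set. \<forall>n. (s n \<in> C a \<and> (n = 0 \<longrightarrow> s n = b)) \<and> s n \<in> underS W (s (Suc n))"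
      by (rule dependent_nat_choice) (use b(1) club_unbounded[OF a] club_subset[OF a] in blast)+
    then show ?thesis by blast
  qed
  then obtain s :: "nat \<Rightarrow> 'a set" where s: "s 0 = b" "\<And>n. s n \<in> C a" "\<And>n. s n \<in> underS W (s (Suc n))"
    by blast
  have sa: "range s \<subseteq> underS W a"
    using s club_subset[OF a] by blast
  show False
  \<comment> \<open>If the supremum of the sequence is \<open>a\<close> itself,
    \<open>otp_small\<close> applies to \<open>a\<close> directly. Otherwise it is some
    \<open>d\<close> below \<open>a\<close>, and coherence identifies \<open>C d\<close>.\<close>
  proof (cases "unbounded_in W a (range s)")
    case True
    then have "cf W a <o \<nu>"
      using countable_cf_ordLess[OF uncountable sa] by blast
    then have "otp W (C a) <o \<nu>"
      using otp_small[OF a] by blast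
    then show False
      using less ordLess_transitive ordLess_irreflexive by blast
  next
    case False
    then obtain x where x: "x \<in> underS W a" "\<And>n. x \<notin> underS W (s n)"
      unfolding unbounded_iff using sa by blast
    have "(s n, x) \<in> W" for n
    proof -
      have "s n \<in> underS W a"
        using sa by blast
      then show ?thesis
        using x wo.not_le_iff_underS[of "s n" x] wo.underS_imp_Field[of _ a] by blast
    qed
    note x = x(1) this
    let ?U = "{z \<in> Field W. \<forall>n. (s n, z) \<in> W}"
    define d where "d = wo.minim ?U"
    have U: "?U \<subseteq> Field W" "?U \<noteq> {}"
      using x wo.underS_imp_Field by blast+
    have d: "d \<in> Field W" "\<And>n. (s n, d) \<in> W" "\<And>z. z \<in> ?U \<Longrightarrow> (d, z) \<in> W"
      unfolding d_def using wo.minim_in[OF U] wo.minim_least[OF U(1)] by blast+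
    have da: "d \<in> underS W a"
      using d(3) x wo.underS_imp_Field wo.le_underS_trans by blast
    have sd: "s n \<in> underS W d" for n
      using s(3) d(2) wo.underS_le_trans by blast
    have unb: "\<exists>c\<in>range s. y \<in> underS W c" if "y \<in> underS W d" for y
    proof (rule ccontr)
      assume "\<not> ?thesis"
      then have "y \<in> ?U"
        using that sd wo.underS_imp_Field wo.not_le_iff_underS by blast
      then show False
        using d(3) that wo.ANTISYM unfolding underS_def antisym_def by blast
    qed
    have lp: "limit_point W (C a) d"
      using unb sd s(2) d(1) by (intro limit_pointI) blast+
    then have Cd: "C d = C a \<inter> underS W d"
      using coherent[OF a da] by blast
    have "cf W d <o \<nu>"
    proof (rule countable_cf_ordLess[OF uncountable])
      show "range s \<subseteq> underS W d"
        using sd by blast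
      then show "unbounded_in W d (range s)"
        unfolding unbounded_iff using unb by blast
    qed
    then have "otp W (C d) <o \<nu>"
      using otp_small lp unfolding limit_point_def by blast
    moreover have "underS W b \<subseteq> underS W d"
      using d(2)[of 0] unfolding s(1) by (blast intro: wo.underS_le_trans)
    moreover have "C d \<subseteq> Field W"
      using Cd wo.underS_imp_Field by blast
    ultimately show False
      using big[of "C d"] unfolding Cd by blast
  qed
qed

text \<open>At a successor ordinal the ladder consists of the predecessor, and at zero it is empty.\<close>

definition ladder :: "'a set \<Rightarrow> 'a set set" where
  "ladder a = (if limit_ordinal W a then C a
     else {c \<in> underS W a. \<forall>x\<in>underS W a. (x, c) \<in> W})"

text \<open>At a limit \<open>a\<close>, the label of a ladder point is its index in the increasing
  enumeration of \<open>C a\<close>, transported into \<nu>; the embedding exists by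
  \<open>otp_C_ordLeq\<close>. Elsewhere the ladder has at most one point, and a constant is
  injective on it.\<close>

definition label :: "'a set \<Rightarrow> 'a set \<Rightarrow> 'a" where
  "label a = (if limit_ordinal W a then SOME f. embed (otp W (C a)) \<nu> f else (\<lambda>_. SOME i. i \<in> Field \<nu>))"

lemma embed_label:
  assumes "limit_ordinal W a"
  shows "embed (otp W (C a)) \<nu> (label a)"
proof -
  have "\<exists>f. embed (otp W (C a)) \<nu> f"
    using otp_C_ordLeq[OF assms] unfolding ordLeq_def by blast
  from someI_ex[OF this] show ?thesis
    using assms unfolding label_def by simp
qed

lemma inj_on_label:
  assumes "a \<in> Field W"
  shows "inj_on (label a) (ladder a)"
proof (cases "limit_ordinal W a")
  case True
  then show ?thesis
    using embed_inj_on[OF Well_order_otp[OF Well_order_W] embed_label[OF True]] Field_otp_C[OF True]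
    by (simp add: ladder_def)
next
  case False
  then show ?thesis
    unfolding ladder_def inj_on_def using wo.ANTISYM by (auto simp: antisym_def)
qed

lemma label_in_Field:
  assumes "a \<in> Field W"
  shows "label a ` ladder a \<subseteq> Field \<nu>"
proof (cases "limit_ordinal W a")
  case True
  then show ?thesis
    using embed_Field[OF embed_label[OF True]] Field_otp_C[OF True] by (simp add: ladder_def)
next
  case False
  have "Field \<nu> \<noteq> {}"
    using uncountable ordLess_imp_ordLeq natLeq_ordLeq_cinfinite cinfinite_mono[OF _ natLeq_cinfinite]
    unfolding cinfinite_def by force
  then show ?thesis
    using False by (auto simp: label_def some_in_eq)
qed

text \<open>A ladder with at most one point accumulates nowhere, so \<open>a\<close> must be a limit
  and its ladder is \<open>C a\<close>.\<close>

lemma accumulation_imp_limit_point: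
  assumes "a \<in> Field W" "b \<in> underS W a" "underS W b \<noteq> {}"
    and acc: "\<And>x. x \<in> underS W b \<Longrightarrow> \<exists>c\<in>ladder a \<inter> underS W b. x \<in> underS W c"
  shows "limit_ordinal W a" and "limit_point W (C a) b"
proof -
  show a: "limit_ordinal W a"
  proof (rule ccontr)
    assume "\<not> limit_ordinal W a"
    then have L: "ladder a = {c \<in> underS W a. \<forall>x\<in>underS W a. (x, c) \<in> W}"
      by (simp add: ladder_def)
    obtain c where c: "c \<in> ladder a \<inter> underS W b"
      using acc assms(3) by blast
    then obtain c' where c': "c' \<in> ladder a" "c \<in> underS W c'"
      using acc by blast
    then have "(c', c) \<in> W" "(c, c') \<in> W" "c \<noteq> c'"
      using c L by (auto simp: underS_def)
    then show False
      using antisymD[OF wo.ANTISYM] by blast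
  qed
  show "limit_point W (C a) b"
    using assms a wo.underS_imp_Field by (intro limit_pointI) (auto simp: ladder_def)
qed

text \<open>Coherence of the ladders is coherence of the square sequence. Coherence of the labels
  follows from it, since \<open>C b\<close> is an initial segment of \<open>C a\<close> and
  embeddings of well-orders are unique.\<close>

lemma walk_ladder: "walk W ladder label"
proof (rule walk.intro)
  show "Well_order W"
    by (rule Well_order_W)
  fix a assume "a \<in> Field W"
  then show "inj_on (label a) (ladder a)"
    by (rule inj_on_label)
  show "ladder a \<subseteq> underS W a"
    using club_subset by (auto simp: ladder_def)
  fix x assume x: "x \<in> underS W a"
  show "\<exists>c\<in>ladder a. (x, c) \<in> W"
  proof (cases "limit_ordinal W a")
    case True
    then show ?thesis
      using club_unbounded[OF True x] by (auto simp: ladder_def underS_def)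
  next
    case False
    \<comment> \<open>A nonzero ordinal that is not a limit has a largest element below it.\<close>
    then have "\<exists>c\<in>underS W a. \<forall>y\<in>underS W a. c \<notin> underS W y"
      using x \<open>a \<in> Field W\<close> unfolding limit_ordinal_def unbounded_iff by blast
    then obtain c where "c \<in> underS W a" "\<forall>y\<in>underS W a. (y, c) \<in> W"
      using wo.not_le_iff_underS wo.underS_imp_Field by blast
    then show ?thesis
      using False x by (auto simp: ladder_def)
  qed
next
  fix a b
  assume ab: "a \<in> Field W" "b \<in> underS W a" "underS W b \<noteq> {}"
    "\<And>x. x \<in> underS W b \<Longrightarrow> \<exists>c\<in>ladder a \<inter> underS W b. x \<in> underS W c"
  note a = accumulation_imp_limit_point(1)[OF ab] and lp = accumulation_imp_limit_point(2)[OF ab]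
  then have b: "limit_ordinal W b"
    unfolding limit_point_def by blast
  have Cb: "C b = C a \<inter> underS W b"
    using coherent[OF a ab(2) lp] .
  then show "ladder b = ladder a \<inter> underS W b"
    using a b by (simp add: ladder_def)
  fix c assume "c \<in> ladder b"
  then have c: "c \<in> Field (otp W (C b))"
    using Field_otp_C[OF b] b by (simp add: ladder_def)
  have eq: "otp W (C b) = Restr (otp W (C a)) (C b)"
    unfolding otp_def Cb by blast
  have "C b \<subseteq> Field (otp W (C a))"
    using Cb Field_otp_C[OF a] by blast
  moreover have "under (otp W (C a)) x \<subseteq> C b" if "x \<in> C b" for x
  proof
    fix y assume "y \<in> under (otp W (C a)) x"
    then have "(y, x) \<in> W" "y \<in> C a"
      by (auto simp: under_def otp_def)
    then show "y \<in> C b"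
      using wo.le_underS_trans Cb that by blast
  qed
  ultimately have "Order_Relation.ofilter (otp W (C a)) (C b)"
    unfolding Order_Relation.ofilter_def by blast
  then have "embed (otp W (C b)) (otp W (C a)) id"
    unfolding eq using ofilter_embed[OF Well_order_otp[OF Well_order_W]] by blast
  from comp_embed[OF this embed_label[OF a]]
  have "embed (otp W (C b)) \<nu> (label a)"
    by simp
  then show "label b c = label a c"
    using embed_unique[OF Well_order_otp[OF Well_order_W] Well_order_\<nu> embed_label[OF b]] c by blast
qed

end

lemma jensen_square_walk:
  assumes "Card_order \<nu>" and "natLeq <o \<nu>" and "jensen_square \<nu>"
  shows "\<exists>D l. walk (cardSuc \<nu>) D l \<and> (\<forall>a\<in>Field (cardSuc \<nu>). l a ` D a \<subseteq> Field \<nu>)"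
proof -
  obtain C where "square \<nu> C"
    using assms unfolding jensen_square_def square_def Let_def by blast
  then show ?thesis
    using square.walk_ladder square.label_in_Field by blast
qed

section \<open>Coherent families of filtrations\<close>

lemma lists_ordLeq_infinite:
  assumes "infinite T"
  shows "|lists T| \<le>o |T|"
proof -
  have "|{xs \<in> lists T. length xs = n}| \<le>o |T|" for n
  proof (induction n)
    case 0
    have "{xs \<in> lists T. length xs = 0} = {[]}"
      by auto
    then show ?case
      using assms card_of_singl_ordLeq[of T "[]"] by fastforce
  next
    case (Suc n)
    have "{xs \<in> lists T. length xs = Suc n} \<subseteq>
        (\<lambda>(x, xs). x # xs) ` (T \<times> {xs \<in> lists T. length xs = n})"
      by (fastforce simp: length_Suc_conv image_iff)
    then have "|{xs \<in> lists T. length xs = Suc n}| \<le>o |T \<times> {xs \<in> lists T. length xs = n}|"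
      by (rule surj_imp_ordLeq)
    also have "|T \<times> {xs \<in> lists T. length xs = n}| \<le>o |T|"
      using Suc by (intro card_of_Sigma_ordLeq_infinite[OF assms card_of_mono1[OF subset_refl]]) blast
    finally show ?case .
  qed
  moreover have "|UNIV :: nat set| \<le>o |T|"
    using assms infinite_iff_card_of_nat by blast
  ultimately have "|\<Union>n\<in>(UNIV :: nat set). {xs \<in> lists T. length xs = n}| \<le>o |T|"
    by (intro card_of_UNION_ordLeq_infinite[OF assms]) auto
  moreover have "(\<Union>n\<in>(UNIV :: nat set). {xs \<in> lists T. length xs = n}) = lists T"
    by auto
  ultimately show ?thesis
    by simp
qed

text \<open>As \<open>S\<close> may be finite, the natural numbers are added to it; the sum is
  infinite and still smaller than \<kappa> because \<omega> < \<kappa>.\<close>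

lemma lists_ordLess:
  assumes "Card_order \<kappa>" and "natLeq <o \<kappa>" and "|S| <o \<kappa>"
  shows "|lists S| <o \<kappa>"
proof -
  let ?T = "S <+> (UNIV :: nat set)"
  have inf: "infinite (Field \<kappa>)"
    using assms(2) cinfinite_mono[OF ordLess_imp_ordLeq natLeq_cinfinite] unfolding cinfinite_def by blast
  have "|lists S| \<le>o |lists ?T|"
    by (rule card_of_ordLeqI[of "map Inl"]) (auto intro!: inj_on_subset[OF inj_mapI])
  also have "|lists ?T| \<le>o |?T|"
    by (rule lists_ordLeq_infinite) simp
  also have "|?T| <o \<kappa>"
    using assms card_of_nat ordIso_ordLess_trans
    by (intro card_of_Plus_ordLess_infinite_Field[OF inf]) blast+
  finally show ?thesis .
qed

section \<open>Filtrations and the family on \<kappa> itself\<close>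

definition trace :: "'k rel \<Rightarrow> ('k \<Rightarrow> 'b set) \<Rightarrow> 'b set" where
  "trace \<kappa> F = (\<Union>j\<in>Field \<kappa>. F j)"

definition filtration :: "'k rel \<Rightarrow> ('k \<Rightarrow> 'b set) \<Rightarrow> bool" where
  "filtration \<kappa> F \<longleftrightarrow>
     (\<forall>i j. (i, j) \<in> \<kappa> \<longrightarrow> F i \<subseteq> F j) \<and> (\<forall>j\<in>Field \<kappa>. |F j| <o \<kappa>)"

definition coherent_family :: "'k rel \<Rightarrow> 'b set \<Rightarrow> ('k \<Rightarrow> 'b set) set \<Rightarrow> bool" where
  "coherent_family \<kappa> S \<F> \<longleftrightarrow>
     (\<forall>F\<in>\<F>. filtration \<kappa> F \<and> trace \<kappa> F \<subseteq> S) \<and>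
     (\<forall>X\<subseteq>S. |X| \<le>o \<kappa> \<longrightarrow> (\<exists>F\<in>\<F>. X \<subseteq> trace \<kappa> F)) \<and>
     (\<forall>F\<in>\<F>. \<forall>G\<in>\<F>. \<exists>j\<in>Field \<kappa>. \<forall>i. (j, i) \<in> \<kappa> \<longrightarrow>
        F i \<inter> trace \<kappa> G = G i \<inter> trace \<kappa> F)"

lemma coherent_familyD:
  assumes "coherent_family \<kappa> S \<F>"
  shows "F \<in> \<F> \<Longrightarrow> filtration \<kappa> F" and "F \<in> \<F> \<Longrightarrow> trace \<kappa> F \<subseteq> S"
    and "X \<subseteq> S \<Longrightarrow> |X| \<le>o \<kappa> \<Longrightarrow> \<exists>F\<in>\<F>. X \<subseteq> trace \<kappa> F"
    and "F \<in> \<F> \<Longrightarrow> G \<in> \<F> \<Longrightarrow> \<exists>j\<in>Field \<kappa>. \<forall>i. (j, i) \<in> \<kappa> \<longrightarrow>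
        F i \<inter> trace \<kappa> G = G i \<inter> trace \<kappa> F"
proof -
  note fam = assms[unfolded coherent_family_def]
  show "F \<in> \<F> \<Longrightarrow> filtration \<kappa> F" "F \<in> \<F> \<Longrightarrow> trace \<kappa> F \<subseteq> S"
    using fam[THEN conjunct1] by blast+
  show "X \<subseteq> S \<Longrightarrow> |X| \<le>o \<kappa> \<Longrightarrow> \<exists>F\<in>\<F>. X \<subseteq> trace \<kappa> F"
    using fam[THEN conjunct2, THEN conjunct1] by blast
  show "F \<in> \<F> \<Longrightarrow> G \<in> \<F> \<Longrightarrow> \<exists>j\<in>Field \<kappa>. \<forall>i. (j, i) \<in> \<kappa> \<longrightarrow>
      F i \<inter> trace \<kappa> G = G i \<inter> trace \<kappa> F"
    by (rule bspec[OF bspec[OF fam[THEN conjunct2, THEN conjunct2]]])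
qed

lemma filtrationD:
  assumes "filtration \<kappa> F"
  shows "(i, j) \<in> \<kappa> \<Longrightarrow> F i \<subseteq> F j" and "j \<in> Field \<kappa> \<Longrightarrow> |F j| <o \<kappa>"
  using assms unfolding filtration_def by blast+

lemma finite_upper_bound:
  assumes "Well_order \<kappa>" and "Field \<kappa> \<noteq> {}" and "finite J" and "J \<subseteq> Field \<kappa>"
  shows "\<exists>m\<in>Field \<kappa>. \<forall>j\<in>J. (j, m) \<in> \<kappa>"
  using assms(3,4)
proof (induction J rule: finite_induct)
  case empty
  then show ?case
    using assms(2) by blast
next
  case (insert i J)
  interpret wo: wo_rel \<kappa>
    using assms(1) by (simp add: wo_rel_def)
  obtain m where m: "m \<in> Field \<kappa>" "\<forall>j\<in>J. (j, m) \<in> \<kappa>"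
    using insert by blast
  show ?case
  proof (cases "(i, m) \<in> \<kappa>")
    case True
    then show ?thesis using m by blast
  next
    case False
    then have "(m, i) \<in> \<kappa>"
      using wo.not_le_iff_underS[of i m] insert.prems m by (auto simp: underS_def)
    moreover have "(i, i) \<in> \<kappa>"
      using wo.REFL insert.prems by (auto simp: refl_on_def)
    ultimately show ?thesis
      using m wo.TRANS insert.prems unfolding trans_def by blast
  qed
qed

text \<open>Finitely many points appear at finitely many stages, and these have a maximum. It is
  applied to the letters of a code and to finite sets of prefixes.\<close>

lemma finite_subset_trace:
  assumes "Well_order \<kappa>" and "Field \<kappa> \<noteq> {}" and "filtration \<kappa> F" and "finite X" and "X \<subseteq> trace \<kappa> F"
  shows "\<exists>m\<in>Field \<kappa>. \<forall>i. (m, i) \<in> \<kappa> \<longrightarrow> X \<subseteq> F i"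
proof -
  have "\<forall>x\<in>X. \<exists>j\<in>Field \<kappa>. x \<in> F j"
    using assms(5) unfolding trace_def by blast
  then obtain j where j: "\<And>x. x \<in> X \<Longrightarrow> j x \<in> Field \<kappa> \<and> x \<in> F (j x)"
    by metis
  obtain m where m: "m \<in> Field \<kappa>" "\<forall>i\<in>j ` X. (i, m) \<in> \<kappa>"
    using finite_upper_bound[OF assms(1,2), of "j ` X"] assms(4) j by blast
  have "X \<subseteq> F i" if "(m, i) \<in> \<kappa>" for i
    using j m(2) filtrationD(1)[OF assms(3)] that by blast
  then show ?thesis
    using m(1) by blast
qed

lemma trace_ordLeq:
  assumes "Card_order \<kappa>" and "infinite (Field \<kappa>)" and "filtration \<kappa> F"
  shows "|trace \<kappa> F| \<le>o \<kappa>"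
  unfolding trace_def
  using assms filtrationD(2)[OF assms(3)] ordLess_imp_ordLeq
  by (intro card_of_UNION_ordLeq_infinite_Field)
    (auto intro: ordIso_imp_ordLeq[OF card_of_Field_ordIso])

text \<open>One filtration suffices, the one by initial segments: they are smaller than \<kappa>
  because \<kappa> is a cardinal, and they exhaust its field because an infinite cardinal is a limit
  ordinal.\<close>

lemma coherent_family_Field:
  assumes "Cinfinite \<kappa>"
  shows "\<exists>\<F>. coherent_family \<kappa> (Field \<kappa>) \<F>"
proof -
  interpret wo: wo_rel \<kappa>
    using assms by (auto simp: wo_rel_def card_order_on_def)
  have inf: "infinite (Field \<kappa>)" and co: "Card_order \<kappa>"
    using assms by (auto simp: cinfinite_def)
  have tr: "trace \<kappa> (underS \<kappa>) = Field \<kappa>"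
    using infinite_Card_order_limit[OF co inf] wo.underS_imp_Field
    by (force simp: trace_def underS_def)
  have "filtration \<kappa> (underS \<kappa>)"
    unfolding filtration_def using wo.underS_le_trans card_of_underS[OF co] by blast
  moreover have "Field \<kappa> \<noteq> {}"
    using inf by auto
  ultimately have "coherent_family \<kappa> (Field \<kappa>) {underS \<kappa>}"
    unfolding coherent_family_def using tr by auto
  then show ?thesis
    by blast
qed

text \<open>\<open>cardSuc\<close> leaves the carrier type, whereas the next cardinal of the chain
  lives on the original one; this carries a family back. Injectivity of \<open>h\<close> makes
  images commute with intersections.\<close>

lemma coherent_family_transfer:
  assumes "coherent_family \<kappa> S \<F>" and "bij_betw h S T"
  shows "coherent_family \<kappa> T ((\<lambda>F j. h ` F j) ` \<F>)"
proof -
  have tr: "trace \<kappa> (\<lambda>j. h ` F j) = h ` trace \<kappa> F" for F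
    unfolding trace_def by blast
  have inj: "inj_on h S" and surj: "h ` S = T"
    using assms(2) by (auto simp: bij_betw_def)
  show ?thesis
    unfolding coherent_family_def ball_simps(9) bex_simps(7) tr
  proof (intro conjI ballI allI impI)
    fix F assume F: "F \<in> \<F>"
    have "|h ` F j| <o \<kappa>" if "j \<in> Field \<kappa>" for j
      using filtrationD(2)[OF coherent_familyD(1)[OF assms(1) F] that] card_of_image
        ordLeq_ordLess_trans by blast
    then show "filtration \<kappa> (\<lambda>j. h ` F j)"
      using filtrationD(1)[OF coherent_familyD(1)[OF assms(1) F]]
      unfolding filtration_def by blast
    show "h ` trace \<kappa> F \<subseteq> T"
      using coherent_familyD(2)[OF assms(1) F] surj by blast
    fix G assume G: "G \<in> \<F>"
    obtain j where j: "j \<in> Field \<kappa>" "\<And>i. (j, i) \<in> \<kappa> \<Longrightarrow> F i \<inter> trace \<kappa> G = G i \<inter> trace \<kappa> F"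
      using coherent_familyD(4)[OF assms(1) F G] by blast
    have "h ` F i \<inter> h ` trace \<kappa> G = h ` G i \<inter> h ` trace \<kappa> F" if "(j, i) \<in> \<kappa>" for i
    proof -
      have "i \<in> Field \<kappa>"
        using that by (auto simp: Field_def)
      then have "F i \<subseteq> trace \<kappa> F" "G i \<subseteq> trace \<kappa> G"
        by (auto simp: trace_def)
      then have "F i \<subseteq> S" "G i \<subseteq> S" "trace \<kappa> F \<subseteq> S" "trace \<kappa> G \<subseteq> S"
        using coherent_familyD(2)[OF assms(1)] F G by blast+
      then show ?thesis
        using j(2)[OF that] inj_on_image_Int[OF inj] by metis
    qed
    then show "\<exists>j\<in>Field \<kappa>. \<forall>i. (j, i) \<in> \<kappa> \<longrightarrow> h ` F i \<inter> h ` trace \<kappa> G = h ` G i \<inter> h ` trace \<kappa> F"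
      using j(1) by blast
  next
    fix X assume X: "X \<subseteq> T" "|X| \<le>o \<kappa>"
    have "|inv_into S h ` X| \<le>o \<kappa>"
      using X(2) card_of_image ordLeq_transitive by blast
    moreover have "inv_into S h ` X \<subseteq> S"
      using X(1) surj by (auto intro: inv_into_into)
    ultimately obtain F where F: "F \<in> \<F>" "inv_into S h ` X \<subseteq> trace \<kappa> F"
      using coherent_familyD(3)[OF assms(1)] by blast
    have "X \<subseteq> h ` trace \<kappa> F"
    proof
      fix x assume "x \<in> X"
      then have "h (inv_into S h x) = x"
        using X(1) surj by (auto intro: f_inv_into_f)
      then show "x \<in> h ` trace \<kappa> F"
        using F(2) \<open>x \<in> X\<close> by (metis image_eqI image_subset_iff)
    qed
    then show "\<exists>F\<in>\<F>. X \<subseteq> h ` trace \<kappa> F"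
      using F(1) by blast
  qed
qed

section \<open>Lifting a family to the successor cardinal\<close>

lemma cardSuc_bounded:
  assumes "Card_order \<nu>" and "infinite (Field \<nu>)" and "X \<subseteq> Field (cardSuc \<nu>)" and "|X| \<le>o \<nu>"
  shows "\<exists>a\<in>Field (cardSuc \<nu>). X \<subseteq> underS (cardSuc \<nu>) a"
proof -
  let ?W = "cardSuc \<nu>"
  interpret wo: wo_rel ?W
    using cardSuc_Well_order[OF assms(1)] by (simp add: wo_rel_def)
  \<comment> \<open>The successor cardinal is regular, so a cofinal subset would have more than
    \<nu> elements.\<close>
  have "\<not> cofinal X ?W"
  proof
    assume "cofinal X ?W"
    then have "|X| =o ?W"
      using infinite_cardSuc_regularCard[OF assms(2,1)] assms(3) unfolding regularCard_def by blast
    then have "?W \<le>o \<nu>"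
      using assms(4) ordIso_symmetric ordIso_ordLeq_trans by blast
    then show False
      using cardSuc_greater[OF assms(1)] not_ordLess_ordLeq by blast
  qed
  then obtain b where b: "b \<in> Field ?W" "\<And>x. x \<in> X \<Longrightarrow> \<not> (b \<noteq> x \<and> (b, x) \<in> ?W)"
    unfolding cofinal_def by blast
  have le: "(x, b) \<in> ?W" if "x \<in> X" for x
    using b(2)[OF that] wo.not_le_iff_underS[of x b] b(1) assms(3) that
    by (auto simp: underS_def)
  \<comment> \<open>\<open>b\<close> bounds \<open>X\<close> only weakly; a strict bound lies above
    it because an infinite cardinal is a limit ordinal.\<close>
  have "infinite (Field ?W)"
    using cardSuc_finite[OF assms(1)] assms(2) by blast
  then obtain a where "a \<in> Field ?W" "b \<in> underS ?W a"
    using infinite_Card_order_limit[OF cardSuc_Card_order[OF assms(1)] _ b(1)]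
    by (auto simp: underS_def)
  then show ?thesis
    using le wo.le_underS_trans by blast
qed

definition code_filtration :: "('b \<Rightarrow> 'c list) \<Rightarrow> 'b set \<Rightarrow> ('k \<Rightarrow> 'c set) \<Rightarrow> 'k \<Rightarrow> 'b set" where
  "code_filtration c U F j = {x \<in> U. set (c x) \<subseteq> F j}"

text \<open>A code is finite, so its letters, if they all occur in the trace, occur together at a
  single stage.\<close>

lemma trace_code_filtration:
  assumes "Well_order \<kappa>" and "Field \<kappa> \<noteq> {}" and "filtration \<kappa> F"
  shows "trace \<kappa> (code_filtration c U F) = {x \<in> U. set (c x) \<subseteq> trace \<kappa> F}"
proof
  show "trace \<kappa> (code_filtration c U F) \<subseteq> {x \<in> U. set (c x) \<subseteq> trace \<kappa> F}"
    by (auto simp: trace_def code_filtration_def)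
  show "{x \<in> U. set (c x) \<subseteq> trace \<kappa> F} \<subseteq> trace \<kappa> (code_filtration c U F)"
  proof
    fix x assume x: "x \<in> {x \<in> U. set (c x) \<subseteq> trace \<kappa> F}"
    then obtain m where m: "m \<in> Field \<kappa>" "\<forall>i. (m, i) \<in> \<kappa> \<longrightarrow> set (c x) \<subseteq> F i"
      using finite_subset_trace[OF assms, of "set (c x)"] by blast
    have "(m, m) \<in> \<kappa>"
      using m(1) assms(1) by (auto simp: order_on_defs refl_on_def)
    then show "x \<in> trace \<kappa> (code_filtration c U F)"
      using x m by (auto simp: trace_def code_filtration_def)
  qed
qed

text \<open>Through \<open>c\<close>, each stage injects into the finite words over
  \<open>F j\<close>, of which there are fewer than \<kappa>.\<close>

lemma filtration_code_filtration:
  assumes "Card_order \<kappa>" and "natLeq <o \<kappa>" and "filtration \<kappa> F" and "inj_on c U"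
  shows "filtration \<kappa> (code_filtration c U F)"
  unfolding filtration_def
proof (intro conjI allI impI ballI)
  show "code_filtration c U F i \<subseteq> code_filtration c U F j" if "(i, j) \<in> \<kappa>" for i j
    using filtrationD(1)[OF assms(3) that] by (auto simp: code_filtration_def)
  fix j assume j: "j \<in> Field \<kappa>"
  have "inj_on c (code_filtration c U F j)" "c ` code_filtration c U F j \<subseteq> lists (F j)"
    using assms(4) by (auto simp: code_filtration_def inj_on_def)
  then have "|code_filtration c U F j| \<le>o |lists (F j)|"
    using card_of_ordLeq by blast
  then show "|code_filtration c U F j| <o \<kappa>"
    using lists_ordLess[OF assms(1,2) filtrationD(2)[OF assms(3) j]] ordLeq_ordLess_trans by blast
qed

text \<open>
  A finite set of prefixes is absorbed by a late stage of the filtrations, after which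
  the two codes of a point contain the same relevant letters.
\<close>

lemma code_filtration_coherent:
  assumes \<kappa>: "Well_order \<kappa>" "Field \<kappa> \<noteq> {}" and F: "filtration \<kappa> F" and G: "filtration \<kappa> G"
    and j0: "j0 \<in> Field \<kappa>" "\<And>i. (j0, i) \<in> \<kappa> \<Longrightarrow> F i \<inter> trace \<kappa> G = G i \<inter> trace \<kappa> F"
    and coh: "prefix_coherent (U \<inter> V) c d"
  shows "\<exists>j\<in>Field \<kappa>. \<forall>i. (j, i) \<in> \<kappa> \<longrightarrow>
    code_filtration c U F i \<inter> trace \<kappa> (code_filtration d V G) =
    code_filtration d V G i \<inter> trace \<kappa> (code_filtration c U F)"
proof -
  obtain P where P: "finite P"
    "\<And>x. x \<in> U \<inter> V \<Longrightarrow> \<exists>u v w. (u, v) \<in> P \<and> c x = u @ w \<and> d x = v @ w"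
    using coh by (rule prefix_coherentE) blast
  \<comment> \<open>Only letters in the traces need to be absorbed: the points compared have both
    codes inside the traces.\<close>
  define A B where "A = (\<Union>p\<in>P. set (fst p))" and "B = (\<Union>p\<in>P. set (snd p))"
  have AB: "finite (A \<inter> trace \<kappa> F)" "finite (B \<inter> trace \<kappa> G)"
    using P(1) by (auto simp: A_def B_def)
  obtain j1 where j1: "j1 \<in> Field \<kappa>" "\<forall>i. (j1, i) \<in> \<kappa> \<longrightarrow> A \<inter> trace \<kappa> F \<subseteq> F i"
    using finite_subset_trace[OF \<kappa> F AB(1) Int_lower2] by blast
  obtain j2 where j2: "j2 \<in> Field \<kappa>" "\<forall>i. (j2, i) \<in> \<kappa> \<longrightarrow> B \<inter> trace \<kappa> G \<subseteq> G i"
    using finite_subset_trace[OF \<kappa> G AB(2) Int_lower2] by blast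
  obtain j where j: "j \<in> Field \<kappa>" "(j0, j) \<in> \<kappa>" "(j1, j) \<in> \<kappa>" "(j2, j) \<in> \<kappa>"
    using finite_upper_bound[OF \<kappa>, of "{j0, j1, j2}"] j0 j1 j2 by auto
  have "trans \<kappa>"
    using \<kappa>(1) by (auto simp: order_on_defs)
  show ?thesis
    unfolding trace_code_filtration[OF \<kappa> F] trace_code_filtration[OF \<kappa> G]
  proof (intro bexI[OF _ j(1)] allI impI)
    fix i assume "(j, i) \<in> \<kappa>"
    then have i: "(j0, i) \<in> \<kappa>" "(j1, i) \<in> \<kappa>" "(j2, i) \<in> \<kappa>" "i \<in> Field \<kappa>"
      using j \<open>trans \<kappa>\<close> unfolding trans_def Field_def by blast+
    have sub: "F i \<subseteq> trace \<kappa> F" "G i \<subseteq> trace \<kappa> G"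
      using i(4) by (auto simp: trace_def)
    have "set (c x) \<subseteq> F i \<longleftrightarrow> set (d x) \<subseteq> G i"
      if x: "x \<in> U" "x \<in> V" "set (c x) \<subseteq> trace \<kappa> F" "set (d x) \<subseteq> trace \<kappa> G" for x
    proof -
      obtain u v w where uvw: "(u, v) \<in> P" "c x = u @ w" "d x = v @ w"
        using P(2) x by blast
      have "set u \<subseteq> A" "set v \<subseteq> B"
        using uvw(1) unfolding A_def B_def by force+
      moreover have "set u \<subseteq> trace \<kappa> F" "set v \<subseteq> trace \<kappa> G"
        using uvw x by auto
      ultimately have "set u \<subseteq> F i" "set v \<subseteq> G i"
        using j1(2) j2(2) i(2,3) by blast+
      \<comment> \<open>The letters of the shared tail lie in both traces, where the stages of
        \<open>F\<close> and \<open>G\<close> agree from \<open>j0\<close> on.\<close>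
      moreover have "set w \<subseteq> F i \<longleftrightarrow> set w \<subseteq> G i"
        using j0(2)[OF i(1)] uvw x sub by auto
      ultimately show ?thesis
        using uvw by auto
    qed
    then show "code_filtration c U F i \<inter> {x \<in> V. set (d x) \<subseteq> trace \<kappa> G} =
        code_filtration d V G i \<inter> {x \<in> U. set (c x) \<subseteq> trace \<kappa> F}"
      using sub unfolding code_filtration_def by blast
  qed
qed

text \<open>A new filtration is given by the start \<open>a\<close> of the walks and a filtration
  \<open>F\<close> of the alphabet. The family is cofinal because at most \<kappa> points lie below
  a common \<open>a\<close> and their codes use at most \<kappa> letters, which the trace of one
  \<open>F\<close> contains.\<close>

lemma coherent_family_cardSuc:
  assumes \<kappa>: "Card_order \<kappa>" "natLeq <o \<kappa>" and \<nu>: "Card_order \<nu>" "\<kappa> \<le>o \<nu>" "jensen_square \<nu>"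
    and fam: "coherent_family \<kappa> (Field \<nu>) \<F>"
  shows "\<exists>\<G>. coherent_family \<kappa> (Field (cardSuc \<nu>)) \<G>"
proof -
  let ?W = "cardSuc \<nu>"
  have wo\<kappa>: "Well_order \<kappa>"
    using \<kappa>(1) by (auto simp: card_order_on_def)
  have "natLeq <o \<nu>"
    using \<kappa>(2) \<nu>(2) ordLess_ordLeq_trans by blast
  then have inf: "infinite (Field \<nu>)"
    using cinfinite_mono[OF ordLess_imp_ordLeq natLeq_cinfinite] unfolding cinfinite_def by blast
  have "infinite (Field \<kappa>)"
    using \<kappa>(2) cinfinite_mono[OF ordLess_imp_ordLeq natLeq_cinfinite] unfolding cinfinite_def by blast
  then have ne: "Field \<kappa> \<noteq> {}"
    by auto
  obtain D l where "walk ?W D l" and l: "\<And>a. a \<in> Field ?W \<Longrightarrow> l a ` D a \<subseteq> Field \<nu>"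
    using jensen_square_walk[OF \<nu>(1) \<open>natLeq <o \<nu>\<close> \<nu>(3)] by blast
  interpret walk ?W D l
    by fact
  define \<Phi> where "\<Phi> a F = code_filtration (code a) (underS ?W a) F" for a and F :: "'a \<Rightarrow> 'b set"
  have tr: "trace \<kappa> (\<Phi> a F) = {x \<in> underS ?W a. set (code a x) \<subseteq> trace \<kappa> F}" if "F \<in> \<F>" for a F
    unfolding \<Phi>_def by (rule trace_code_filtration[OF wo\<kappa> ne coherent_familyD(1)[OF fam that]])
  have "coherent_family \<kappa> (Field ?W) {\<Phi> a F | a F. a \<in> Field ?W \<and> F \<in> \<F>}"
    unfolding coherent_family_def
  proof (intro conjI ballI allI impI)
    fix F' assume "F' \<in> {\<Phi> a F | a F. a \<in> Field ?W \<and> F \<in> \<F>}"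
    then obtain a F where F': "F' = \<Phi> a F" and aF: "a \<in> Field ?W" "F \<in> \<F>"
      by blast
    show "filtration \<kappa> F'"
      unfolding F' \<Phi>_def
      by (rule filtration_code_filtration[OF \<kappa> coherent_familyD(1)[OF fam aF(2)] inj_on_code[OF aF(1)]])
    show "trace \<kappa> F' \<subseteq> Field ?W"
      unfolding F' tr[OF aF(2)] using wo.underS_imp_Field by blast
    fix G' assume "G' \<in> {\<Phi> a F | a F. a \<in> Field ?W \<and> F \<in> \<F>}"
    then obtain b G where G': "G' = \<Phi> b G" and bG: "b \<in> Field ?W" "G \<in> \<F>"
      by blast
    obtain j where "j \<in> Field \<kappa>" "\<And>i. (j, i) \<in> \<kappa> \<Longrightarrow> F i \<inter> trace \<kappa> G = G i \<inter> trace \<kappa> F"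
      using coherent_familyD(4)[OF fam aF(2) bG(2)] by blast
    from code_filtration_coherent[OF wo\<kappa> ne coherent_familyD(1)[OF fam aF(2)]
        coherent_familyD(1)[OF fam bG(2)] this code_coherent[OF aF(1) bG(1)]]
    show "\<exists>j\<in>Field \<kappa>. \<forall>i. (j, i) \<in> \<kappa> \<longrightarrow> F' i \<inter> trace \<kappa> G' = G' i \<inter> trace \<kappa> F'"
      unfolding F' G' \<Phi>_def .
  next
    fix X assume X: "X \<subseteq> Field ?W" "|X| \<le>o \<kappa>"
    then obtain a where a: "a \<in> Field ?W" "X \<subseteq> underS ?W a"
      using cardSuc_bounded[OF \<nu>(1) inf X(1)] \<nu>(2) ordLeq_transitive by blast
    have "|\<Union>x\<in>X. set (code a x)| \<le>o \<kappa>"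
    proof (rule card_of_UNION_ordLeq_infinite_Field[OF \<open>infinite (Field \<kappa>)\<close> \<kappa>(1) X(2)], rule ballI)
      fix x
      have "|set (code a x)| <o natLeq"
        using finite_iff_ordLess_natLeq by blast
      then show "|set (code a x)| \<le>o \<kappa>"
        using \<kappa>(2) ordLess_transitive ordLess_imp_ordLeq by blast
    qed
    moreover have "(\<Union>x\<in>X. set (code a x)) \<subseteq> Field \<nu>"
      using code_in_lists[OF l a(1)] a(2) by blast
    ultimately obtain F where F: "F \<in> \<F>" "(\<Union>x\<in>X. set (code a x)) \<subseteq> trace \<kappa> F"
      using coherent_familyD(3)[OF fam] by blast
    show "\<exists>F'\<in>{\<Phi> a F | a F. a \<in> Field ?W \<and> F \<in> \<F>}. X \<subseteq> trace \<kappa> F'"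
    proof (rule bexI)
      show "X \<subseteq> trace \<kappa> (\<Phi> a F)"
        unfolding tr[OF F(1)] using F(2) a(2) by blast
      show "\<Phi> a F \<in> {\<Phi> a F | a F. a \<in> Field ?W \<and> F \<in> \<F>}"
        using F(1) a(1) by blast
    qed
  qed
  then show ?thesis
    by blast
qed

section \<open>Families on the finite successors of \<kappa>\<close>

lemma is_nth_cardSuc_Card_order:
  fixes lam :: "'a rel"
  assumes "Card_order \<kappa>" and "is_nth_cardSuc n \<kappa> lam"
  shows "Card_order lam \<and> \<kappa> \<le>o lam"
  using assms(2)
proof (induction n arbitrary: lam)
  case 0
  then show ?case
    using assms(1) Card_order_ordIso[of \<kappa> lam] ordIso_symmetric ordIso_imp_ordLeq by auto
next
  case (Suc n)
  then obtain \<mu> :: "'a rel" where \<mu>: "is_nth_cardSuc n \<kappa> \<mu>" "lam =o cardSuc \<mu>"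
    by auto
  then have "Card_order \<mu>" "\<kappa> \<le>o \<mu>"
    using Suc.IH by blast+
  then show ?case
    using \<mu>(2) Card_order_ordIso cardSuc_Card_order cardSuc_ordLeq ordLeq_transitive
      ordIso_symmetric ordLeq_ordIso_trans by metis
qed

text \<open>Induction along the chain of successors. The intermediate cardinals are taken on the
  type of \<open>lam\<close>, over which the square assumption ranges, and they inherit that
  assumption because they are smaller than \<open>lam\<close>.\<close>

lemma coherent_family_exists:
  fixes \<kappa> :: "'k rel" and lam :: "'a rel"
  assumes \<kappa>: "Card_order \<kappa>" "natLeq <o \<kappa>"
    and "is_nth_cardSuc n \<kappa> lam"
    and "\<And>\<nu> :: 'a rel. Card_order \<nu> \<Longrightarrow> \<kappa> \<le>o \<nu> \<Longrightarrow> \<nu> <o lam \<Longrightarrow> jensen_square \<nu>"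
  shows "\<exists>\<F>. coherent_family \<kappa> (Field lam) \<F>"
  using assms(3,4)
proof (induction n arbitrary: lam)
  case 0
  have "Cinfinite \<kappa>"
    using \<kappa> cinfinite_mono[OF ordLess_imp_ordLeq natLeq_cinfinite] by blast
  moreover obtain h where "bij_betw h (Field \<kappa>) (Field lam)"
    using card_of_cong[of lam \<kappa>] 0 card_of_ordIso ordIso_symmetric is_nth_cardSuc.simps(1) by metis
  ultimately show ?case
    using coherent_family_Field coherent_family_transfer by metis
next
  case (Suc n)
  then obtain \<mu> :: "'a rel" where \<mu>: "is_nth_cardSuc n \<kappa> \<mu>" "lam =o cardSuc \<mu>"
    by auto
  then have co: "Card_order \<mu>" "\<kappa> \<le>o \<mu>"
    using is_nth_cardSuc_Card_order[OF \<kappa>(1)] by blast+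
  have less: "\<mu> <o lam"
    using cardSuc_greater[OF co(1)] \<mu>(2) ordIso_symmetric ordLess_ordIso_trans by blast
  have "\<exists>\<F>. coherent_family \<kappa> (Field \<mu>) \<F>"
    using Suc.IH[OF \<mu>(1)] Suc.prems(2) less ordLess_transitive by blast
  then obtain \<F> where "coherent_family \<kappa> (Field (cardSuc \<mu>)) \<F>"
    using coherent_family_cardSuc[OF \<kappa> co Suc.prems(2)[OF co less]] by blast
  moreover obtain h where "bij_betw h (Field (cardSuc \<mu>)) (Field lam)"
    using card_of_cong[OF \<mu>(2)] card_of_ordIso ordIso_symmetric by metis
  ultimately show ?case
    using coherent_family_transfer by blast
qed

section \<open>The group of tame permutations\<close>

text \<open>If \<kappa> were shorter than \<open>r\<close>, it would be isomorphic to a proper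
  initial segment of \<open>r\<close>, which is too small. Conversely, a cardinal is the shortest
  well-order of its size.\<close>

lemma ordIso_Card_orderI:
  assumes "Card_order \<kappa>" and "Well_order r" and "|Field r| =o \<kappa>"
    and "\<And>a. a \<in> Field r \<Longrightarrow> |underS r a| <o \<kappa>"
  shows "r =o \<kappa>"
proof -
  have wo\<kappa>: "Well_order \<kappa>"
    using assms(1) by (auto simp: card_order_on_def)
  have "\<not> \<kappa> <o r"
  proof
    assume "\<kappa> <o r"
    then obtain a where a: "a \<in> Field r" "\<kappa> =o Restr r (underS r a)"
      using ordLess_iff_ordIso_Restr[OF assms(2) wo\<kappa>] by blast
    have "\<kappa> =o |Field \<kappa>|"
      using card_of_Field_ordIso[OF assms(1)] ordIso_symmetric by blast
    also have "|Field \<kappa>| =o |Field (Restr r (underS r a))|"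
      using a(2) by (rule card_of_cong)
    also have "|Field (Restr r (underS r a))| \<le>o |underS r a|"
      by (rule card_of_mono1[OF Field_Restr_subset])
    also have "|underS r a| <o \<kappa>"
      using assms(4) a(1) by blast
    finally show False
      using ordLess_irreflexive by blast
  qed
  then have "r \<le>o \<kappa>"
    using not_ordLess_iff_ordLeq[OF assms(2) wo\<kappa>] by blast
  moreover have "\<kappa> \<le>o r"
    using ordIso_ordLeq_trans[OF ordIso_symmetric[OF assms(3)] card_of_least[OF assms(2)]] .
  ultimately show ?thesis
    using ordIso_iff_ordLeq by blast
qed

lemma ordLeq_card_of_subset:
  assumes "Card_order \<kappa>" and "\<kappa> \<le>o |A|"
  shows "\<exists>B\<subseteq>A. |B| =o \<kappa>"
proof -
  have "|Field \<kappa>| \<le>o |A|"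
    using card_of_Field_ordIso[OF assms(1)] assms(2) ordIso_ordLeq_trans by blast
  then obtain f where f: "inj_on f (Field \<kappa>)" "f ` Field \<kappa> \<subseteq> A"
    using card_of_ordLeq by metis
  then have "|Field \<kappa>| =o |f ` Field \<kappa>|"
    using card_of_ordIsoI inj_on_imp_bij_betw by blast
  then have "|f ` Field \<kappa>| =o \<kappa>"
    using card_of_Field_ordIso[OF assms(1)] ordIso_symmetric ordIso_transitive by blast
  then show ?thesis
    using f(2) by blast
qed

text \<open>The converse of a finite well-order is again a well-order, and any two well-orders of
  one finite set are isomorphic.\<close>

lemma finite_order_reversal:
  assumes "well_order_on S r" and "finite S"
  shows "\<exists>p. bij_betw p S S \<and> (\<forall>x y. (x, y) \<in> r \<longrightarrow> (p y, p x) \<in> r)"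
proof -
  have lin: "linear_order_on S r" and wf: "wf (r - Id)"
    using assms(1) by (auto simp: well_order_on_def)
  have sub: "r \<subseteq> S \<times> S"
    using assms(1) by (auto simp: order_on_defs)
  then have "finite r"
    using assms(2) finite_subset by blast
  then have "wf ((r - Id)\<inverse>)"
    using finite_acyclic_wf_converse wf_acyclic[OF wf] by blast
  then have "wf (r\<inverse> - Id)"
    by (rule wf_subset) auto
  then have "well_order_on S (r\<inverse>)"
    using lin by (simp add: well_order_on_def)
  then have "r =o r\<inverse>"
    using finite_well_order_on_ordIso[OF assms(2,1)] by blast
  then obtain p where p: "BNF_Wellorder_Embedding.iso r (r\<inverse>) p"
    unfolding ordIso_def by blast
  have "Field r = S"
    using assms(1) well_order_on_Field by blast
  then have "bij_betw p S S"
    using p by (simp add: BNF_Wellorder_Embedding.iso_def)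
  moreover have "(p y, p x) \<in> r" if "(x, y) \<in> r" for x y
    using iso_forward[OF that p] by simp
  ultimately show ?thesis
    by blast
qed

section \<open>The well-orders induced by filtrations\<close>

locale coherent_orders =
  fixes \<kappa> :: "'k rel" and lam :: "'a rel" and \<F> :: "('k \<Rightarrow> 'a set) set"
  assumes \<kappa>: "Card_order \<kappa>" "infinite (Field \<kappa>)"
    and lam: "Card_order lam" "\<kappa> \<le>o lam"
    and fam: "coherent_family \<kappa> (Field lam) \<F>"
begin

abbreviation "tr \<equiv> trace \<kappa>"

sublocale k: wo_rel \<kappa>
  using \<kappa>(1) by (simp add: wo_rel_def card_order_on_def)

sublocale w: wo_rel lam
  using lam(1) by (simp add: wo_rel_def card_order_on_def)

definition rank :: "('k \<Rightarrow> 'a set) \<Rightarrow> 'a \<Rightarrow> 'k" where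
  "rank F x = k.minim {j \<in> Field \<kappa>. x \<in> F j}"

text \<open>The tie-break by \<open>lam\<close> does not depend on \<open>F\<close>, so two of these
  orders can differ on common points only through the ranks.\<close>

definition ord :: "('k \<Rightarrow> 'a set) \<Rightarrow> 'a rel" where
  "ord F = {(x, y). x \<in> tr F \<and> y \<in> tr F \<and>
     (rank F x \<in> underS \<kappa> (rank F y) \<or> rank F x = rank F y \<and> (x, y) \<in> lam)}"

lemma rank:
  assumes "x \<in> tr F"
  shows "rank F x \<in> Field \<kappa>" and "x \<in> F (rank F x)"
  using k.minim_in[of "{j \<in> Field \<kappa>. x \<in> F j}"] assms unfolding rank_def trace_def by blast+

lemma trace_subset: "F \<in> \<F> \<Longrightarrow> tr F \<subseteq> Field lam"
  using coherent_familyD(2)[OF fam] .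

lemma small_Un: "|A| <o \<kappa> \<Longrightarrow> |B| <o \<kappa> \<Longrightarrow> |A \<union> B| <o \<kappa>"
  using card_of_Un_ordLess_infinite_Field[OF \<kappa>(2,1)] .

lemma small_subset: "|B| <o \<kappa> \<Longrightarrow> A \<subseteq> B \<Longrightarrow> |A| <o \<kappa>"
  using card_of_mono1 ordLeq_ordLess_trans by blast

lemma well_order_ord:
  assumes "F \<in> \<F>"
  shows "well_order_on (tr F) (ord F)"
proof -
  have T: "\<And>x y z. (x, y) \<in> lam \<Longrightarrow> (y, z) \<in> lam \<Longrightarrow> (x, z) \<in> lam"
    using w.TRANS unfolding trans_def by blast
  have irr: "\<And>i. i \<notin> underS \<kappa> i"
    by (simp add: underS_def)
  have "refl_on (tr F) (ord F)"
    using w.REFL trace_subset[OF assms] unfolding refl_on_def ord_def by blast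
  moreover have "ord F \<subseteq> tr F \<times> tr F"
    by (auto simp: ord_def)
  moreover have "trans (ord F)"
    by (rule transI) (auto simp: ord_def intro: k.underS_trans T)
  moreover have "antisym (ord F)"
    by (rule antisymI)
      (auto simp: ord_def irr dest: k.underS_trans antisymD[OF w.ANTISYM])
  moreover have "total_on (tr F) (ord F)"
  proof (rule total_onI)
    fix x y assume xy: "x \<in> tr F" "y \<in> tr F" "x \<noteq> y"
    have "rank F x \<in> underS \<kappa> (rank F y) \<or> rank F x = rank F y \<or> rank F y \<in> underS \<kappa> (rank F x)"
      using rank(1)[OF xy(1)] rank(1)[OF xy(2)] k.not_le_iff_underS by (auto simp: underS_def)
    moreover have "(x, y) \<in> lam \<or> (y, x) \<in> lam"
      using w.TOTAL xy trace_subset[OF assms] unfolding total_on_def by blast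
    ultimately show "(x, y) \<in> ord F \<or> (y, x) \<in> ord F"
      using xy unfolding ord_def by auto
  qed
  moreover have "wf (ord F - Id)"
  proof (rule wf_subset)
    show "wf (inv_image ((\<kappa> - Id) <*lex*> (lam - Id)) (\<lambda>x. (rank F x, x)))"
      using k.WF w.WF by (intro wf_inv_image wf_lex_prod)
    show "ord F - Id \<subseteq> inv_image ((\<kappa> - Id) <*lex*> (lam - Id)) (\<lambda>x. (rank F x, x))"
      by (auto simp: ord_def underS_def)
  qed
  ultimately show ?thesis
    unfolding order_on_defs by blast
qed

lemma Field_ord: "F \<in> \<F> \<Longrightarrow> Field (ord F) = tr F"
  and Well_order_ord: "F \<in> \<F> \<Longrightarrow> Well_order (ord F)"
  using well_order_ord[of F] well_order_on_Field well_order_on_Well_order by blast+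

lemma well_order_Restr_ord:
  assumes "F \<in> \<F>" and "X \<subseteq> tr F"
  shows "well_order_on X (Restr (ord F) X)"
  using well_order_on_Restr[OF Well_order_ord] Field_ord assms by metis

lemma ord_total: "F \<in> \<F> \<Longrightarrow> x \<in> tr F \<Longrightarrow> y \<in> tr F \<Longrightarrow> (x, y) \<in> ord F \<or> (y, x) \<in> ord F"
  using wo_rel.TOTALS[of "ord F"] by (simp add: wo_rel_def well_order_ord Field_ord)

lemma ord_antisym: "F \<in> \<F> \<Longrightarrow> (x, y) \<in> ord F \<Longrightarrow> (y, x) \<in> ord F \<Longrightarrow> x = y"
  using antisymD[OF wo_rel.ANTISYM[of "ord F"]] by (simp add: wo_rel_def well_order_ord Field_ord)

lemma ord_trace: "(x, y) \<in> ord F \<Longrightarrow> x \<in> tr F \<and> y \<in> tr F"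
  by (simp add: ord_def)

text \<open>The predecessors of \<open>a\<close> have at most the rank of \<open>a\<close>, so they
  lie in the stage \<open>F (rank F a)\<close>, which is smaller than \<kappa>.\<close>

lemma ordIso_Restr_ord:
  assumes "F \<in> \<F>" and "X \<subseteq> tr F" and "|X| =o \<kappa>"
  shows "well_order_on X (Restr (ord F) X)" and "Restr (ord F) X =o \<kappa>"
proof -
  show wo: "well_order_on X (Restr (ord F) X)"
    using well_order_Restr_ord[OF assms(1,2)] .
  then have F: "Field (Restr (ord F) X) = X" "Well_order (Restr (ord F) X)"
    using well_order_on_Field well_order_on_Well_order by blast+
  show "Restr (ord F) X =o \<kappa>"
  proof (rule ordIso_Card_orderI[OF \<kappa>(1) F(2)])
    show "|Field (Restr (ord F) X)| =o \<kappa>"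
      using assms(3) F(1) by simp
    fix a assume "a \<in> Field (Restr (ord F) X)"
    then have a: "a \<in> tr F"
      using F(1) assms(2) by blast
    have "underS (Restr (ord F) X) a \<subseteq> F (rank F a)"
    proof
      fix x assume "x \<in> underS (Restr (ord F) X) a"
      then have x: "x \<in> tr F" "(rank F x, rank F a) \<in> \<kappa>"
        using k.REFL rank(1)[OF a] by (auto simp: underS_def ord_def refl_on_def)
      then show "x \<in> F (rank F a)"
        using rank(2)[OF x(1)] filtrationD(1)[OF coherent_familyD(1)[OF fam assms(1)] x(2)] by blast
    qed
    then show "|underS (Restr (ord F) X) a| <o \<kappa>"
      using small_subset filtrationD(2)[OF coherent_familyD(1)[OF fam assms(1)] rank(1)[OF a]]
      by blast
  qed
qed

lemma order_matching:
  assumes "F \<in> \<F>" and "X \<subseteq> tr F" "|X| =o \<kappa>" and "Y \<subseteq> tr F" "|Y| =o \<kappa>"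
  shows "\<exists>h. bij_betw h X Y \<and> (\<forall>x\<in>X. \<forall>y\<in>X. (x, y) \<in> ord F \<longrightarrow> (h x, h y) \<in> ord F)"
proof -
  note X = ordIso_Restr_ord[OF assms(1-3)] and Y = ordIso_Restr_ord[OF assms(1,4,5)]
  have "Restr (ord F) X =o Restr (ord F) Y"
    using X(2) Y(2) ordIso_symmetric ordIso_transitive by blast
  then obtain h where h: "BNF_Wellorder_Embedding.iso (Restr (ord F) X) (Restr (ord F) Y) h"
    unfolding ordIso_def by blast
  have "Field (Restr (ord F) X) = X" "Field (Restr (ord F) Y) = Y"
    using X(1) Y(1) well_order_on_Field by blast+
  then have "bij_betw h X Y"
    using h by (simp add: BNF_Wellorder_Embedding.iso_def)
  moreover have "(h x, h y) \<in> ord F" if "x \<in> X" "y \<in> X" "(x, y) \<in> ord F" for x y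
    using iso_forward[OF _ h, of x y] that by blast
  ultimately show ?thesis
    by blast
qed

text \<open>If the stages agree from \<open>j\<close> on, take \<open>E\<close> to be the union of
  \<open>F j\<close> and \<open>G j\<close>. A common point outside \<open>E\<close> appears after
  \<open>j\<close> in both filtrations, hence with the same rank.\<close>

lemma ord_agree:
  assumes "F \<in> \<F>" and "G \<in> \<F>"
  shows "\<exists>E. |E| <o \<kappa> \<and> (\<forall>x\<in>tr F \<inter> tr G - E. \<forall>y\<in>tr F \<inter> tr G - E. (x, y) \<in> ord F \<longleftrightarrow> (x, y) \<in> ord G)"
proof -
  obtain j where j: "j \<in> Field \<kappa>" "\<And>i. (j, i) \<in> \<kappa> \<Longrightarrow> F i \<inter> tr G = G i \<inter> tr F"
    using coherent_familyD(4)[OF fam assms] by blast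
  have "rank F x = rank G x" if x: "x \<in> tr F" "x \<in> tr G" "x \<notin> F j" "x \<notin> G j" for x
  proof -
    have "x \<in> F i \<longleftrightarrow> x \<in> G i" if "i \<in> Field \<kappa>" for i
    proof (cases "(j, i) \<in> \<kappa>")
      case True
      then show ?thesis
        using j(2) x by blast
    next
      case False
      then have "(i, j) \<in> \<kappa>"
        using k.not_le_iff_underS[OF j(1) that] by (simp add: underS_def)
      then have "F i \<subseteq> F j" "G i \<subseteq> G j"
        using filtrationD(1)[OF coherent_familyD(1)[OF fam assms(1)]]
          filtrationD(1)[OF coherent_familyD(1)[OF fam assms(2)]] by simp_all
      then show ?thesis
        using x by blast
    qed
    then have "{i \<in> Field \<kappa>. x \<in> F i} = {i \<in> Field \<kappa>. x \<in> G i}"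
      by blast
    then show ?thesis
      unfolding rank_def by simp
  qed
  then have "\<forall>x\<in>tr F \<inter> tr G - (F j \<union> G j). \<forall>y\<in>tr F \<inter> tr G - (F j \<union> G j). (x, y) \<in> ord F \<longleftrightarrow> (x, y) \<in> ord G"
    by (simp add: ord_def)
  moreover have "|F j \<union> G j| <o \<kappa>"
    using small_Un filtrationD(2)[OF coherent_familyD(1)[OF fam] j(1)] assms by blast
  ultimately show ?thesis
    by blast
qed

text \<open>\<open>c\<close> colours the finitely many pieces, by numbers so that colours can be
  paired. Pairs outside \<open>tr F\<close>, or with an image outside \<open>tr G\<close>, are not
  constrained; \<open>tame_group\<close> makes up for this by asking for all \<open>F\<close> and
  \<open>G\<close>, whose traces cover every set of size at most \<kappa>.\<close>

definition tame :: "('k \<Rightarrow> 'a set) \<Rightarrow> ('k \<Rightarrow> 'a set) \<Rightarrow> ('a \<Rightarrow> 'a) \<Rightarrow> bool" where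
  "tame F G g \<longleftrightarrow> (\<exists>E (c :: 'a \<Rightarrow> nat). |E| <o \<kappa> \<and> finite (range c) \<and>
     (\<forall>x y. x \<notin> E \<longrightarrow> y \<notin> E \<longrightarrow> c x = c y \<longrightarrow> (x, y) \<in> ord F \<longrightarrow>
        g x \<in> tr G \<longrightarrow> g y \<in> tr G \<longrightarrow> (g x, g y) \<in> ord G))"

definition tame_group :: "('a \<Rightarrow> 'a) set" where
  "tame_group = {g \<in> Bij (Field lam). \<forall>F\<in>\<F>. \<forall>G\<in>\<F>. tame F G g}"

lemma tameE:
  assumes "tame F G g"
  obtains E and c :: "'a \<Rightarrow> nat" where "|E| <o \<kappa>" and "finite (range c)"
    and "\<And>x y. \<lbrakk>x \<notin> E; y \<notin> E; c x = c y; (x, y) \<in> ord F; g x \<in> tr G; g y \<in> tr G\<rbrakk>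
      \<Longrightarrow> (g x, g y) \<in> ord G"
  using assms unfolding tame_def by blast

lemma tameI:
  fixes c :: "'a \<Rightarrow> nat"
  assumes "|E| <o \<kappa>" and "finite (range c)"
    and "\<And>x y. \<lbrakk>x \<notin> E; y \<notin> E; c x = c y; (x, y) \<in> ord F; g x \<in> tr G; g y \<in> tr G\<rbrakk>
      \<Longrightarrow> (g x, g y) \<in> ord G"
  shows "tame F G g"
  unfolding tame_def using assms by blast

lemma tame_groupD:
  assumes "g \<in> tame_group"
  shows "g \<in> Bij (Field lam)" and "bij_betw g (Field lam) (Field lam)"
    and "F \<in> \<F> \<Longrightarrow> G \<in> \<F> \<Longrightarrow> tame F G g"
  using assms by (auto simp: tame_group_def Bij_def)

text \<open>A filtration is needed between \<open>F\<close> and \<open>G\<close>: the image of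
  \<open>tr F\<close> under \<open>g\<close> has size at most \<kappa>, so the trace of some
  \<open>K\<close> in the family contains it. The pieces of \<open>g\<close> are then refined by the
  preimages of those of \<open>h\<close>.\<close>

lemma tame_compose:
  assumes g: "g \<in> tame_group" and h: "h \<in> tame_group" and FG: "F \<in> \<F>" "G \<in> \<F>"
  shows "tame F G (compose (Field lam) h g)"
proof -
  have "|g ` tr F| \<le>o \<kappa>"
    using trace_ordLeq[OF \<kappa> coherent_familyD(1)[OF fam FG(1)]] card_of_image ordLeq_transitive
    by blast
  moreover have "g ` tr F \<subseteq> Field lam"
    using tame_groupD(2)[OF g] trace_subset[OF FG(1)] by (auto simp: bij_betw_def)
  ultimately obtain K where K: "K \<in> \<F>" "g ` tr F \<subseteq> tr K"
    using coherent_familyD(3)[OF fam] by blast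
  obtain E c where E: "|E| <o \<kappa>" "finite (range (c :: 'a \<Rightarrow> nat))"
    "\<And>x y. \<lbrakk>x \<notin> E; y \<notin> E; c x = c y; (x, y) \<in> ord F; g x \<in> tr K; g y \<in> tr K\<rbrakk>
      \<Longrightarrow> (g x, g y) \<in> ord K"
    using tame_groupD(3)[OF g FG(1) K(1)] by (rule tameE) blast
  obtain E' c' where E': "|E'| <o \<kappa>" "finite (range (c' :: 'a \<Rightarrow> nat))"
    "\<And>x y. \<lbrakk>x \<notin> E'; y \<notin> E'; c' x = c' y; (x, y) \<in> ord K; h x \<in> tr G; h y \<in> tr G\<rbrakk>
      \<Longrightarrow> (h x, h y) \<in> ord G"
    using tame_groupD(3)[OF h K(1) FG(2)] by (rule tameE) blast
  let ?E = "E \<union> {x \<in> Field lam. g x \<in> E'}" and ?c = "\<lambda>x. prod_encode (c x, c' (g x))"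
  show ?thesis
  proof (rule tameI[of ?E ?c])
    have "|{x \<in> Field lam. g x \<in> E'}| \<le>o |E'|"
      using tame_groupD(2)[OF g] by (intro card_of_ordLeqI[of g]) (auto simp: bij_betw_def inj_on_def)
    then show "|?E| <o \<kappa>"
      using E(1) E'(1) small_Un ordLeq_ordLess_trans by blast
    have "range ?c \<subseteq> prod_encode ` (range c \<times> range c')"
      by auto
    then show "finite (range ?c)"
      using E(2) E'(2) finite_subset by blast
    fix x y
    assume xy: "x \<notin> ?E" "y \<notin> ?E" "?c x = ?c y" "(x, y) \<in> ord F"
      "compose (Field lam) h g x \<in> tr G" "compose (Field lam) h g y \<in> tr G"
    have tr: "x \<in> tr F" "y \<in> tr F"
      using ord_trace[OF xy(4)] by auto
    then have in_lam: "x \<in> Field lam" "y \<in> Field lam"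
      using trace_subset[OF FG(1)] by auto
    have "(g x, g y) \<in> ord K"
      using xy tr K(2) by (intro E(3)) auto
    then have "(h (g x), h (g y)) \<in> ord G"
      using xy in_lam by (intro E'(3)) (auto simp: compose_def)
    then show "(compose (Field lam) h g x, compose (Field lam) h g y) \<in> ord G"
      using in_lam by (simp add: compose_def)
  qed
qed

text \<open>The inverse is increasing on the image of each piece because \<open>ord G\<close> is
  total: if it reversed a pair, \<open>g\<close> would reverse the pair back, against
  antisymmetry.\<close>

lemma tame_inverse:
  assumes g: "g \<in> tame_group" and FG: "F \<in> \<F>" "G \<in> \<F>"
  shows "tame F G (\<lambda>x\<in>Field lam. inv_into (Field lam) g x)"
proof -
  let ?g' = "\<lambda>x\<in>Field lam. inv_into (Field lam) g x"
  obtain E c where E: "|E| <o \<kappa>" "finite (range (c :: 'a \<Rightarrow> nat))"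
    "\<And>x y. \<lbrakk>x \<notin> E; y \<notin> E; c x = c y; (x, y) \<in> ord G; g x \<in> tr F; g y \<in> tr F\<rbrakk>
      \<Longrightarrow> (g x, g y) \<in> ord F"
    using tame_groupD(3)[OF g FG(2,1)] by (rule tameE) blast
  show ?thesis
  proof (rule tameI[of "g ` E" "\<lambda>x. c (?g' x)"])
    show "|g ` E| <o \<kappa>"
      using E(1) card_of_image ordLeq_ordLess_trans by blast
    have "range (\<lambda>x. c (?g' x)) \<subseteq> range c"
      by blast
    then show "finite (range (\<lambda>x. c (?g' x)))"
      using E(2) finite_subset by blast
    fix x y
    assume xy: "x \<notin> g ` E" "y \<notin> g ` E" "c (?g' x) = c (?g' y)" "(x, y) \<in> ord F"
      "?g' x \<in> tr G" "?g' y \<in> tr G"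
    have tr: "x \<in> tr F" "y \<in> tr F"
      using ord_trace[OF xy(4)] by auto
    then have "x \<in> Field lam" "y \<in> Field lam"
      using trace_subset[OF FG(1)] by auto
    then have inv: "g (?g' x) = x" "g (?g' y) = y"
      using tame_groupD(2)[OF g] by (auto simp: bij_betw_def f_inv_into_f)
    then have "?g' x \<notin> E" "?g' y \<notin> E"
      using xy(1,2) by (metis imageI)+
    show "(?g' x, ?g' y) \<in> ord G"
    proof (rule ccontr)
      assume contr: "(?g' x, ?g' y) \<notin> ord G"
      then have "(?g' y, ?g' x) \<in> ord G"
        using ord_total[OF FG(2)] xy(5,6) by blast
      then have "(g (?g' y), g (?g' x)) \<in> ord F"
        using \<open>?g' x \<notin> E\<close> \<open>?g' y \<notin> E\<close> xy(3) tr inv by (intro E(3)) auto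
      then have "x = y"
        using ord_antisym[OF FG(1)] xy(4) inv by simp
      then show False
        using contr ord_total[OF FG(2) xy(5,5)] by simp
    qed
  qed
qed

text \<open>Even the identity has to carry \<open>ord F\<close> to \<open>ord G\<close>; it does so
  with one piece because the two orders agree off a small set.\<close>

lemma tame_id:
  assumes "F \<in> \<F>" and "G \<in> \<F>"
  shows "tame F G (\<lambda>x\<in>Field lam. x)"
proof -
  obtain E where E: "|E| <o \<kappa>"
    "\<forall>x\<in>tr F \<inter> tr G - E. \<forall>y\<in>tr F \<inter> tr G - E. (x, y) \<in> ord F \<longleftrightarrow> (x, y) \<in> ord G"
    using ord_agree[OF assms] by blast
  show ?thesis
  proof (rule tameI[OF E(1), of "\<lambda>_. 0"])
    fix x y
    assume xy: "x \<notin> E" "y \<notin> E" "(x, y) \<in> ord F"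
      "(\<lambda>x\<in>Field lam. x) x \<in> tr G" "(\<lambda>x\<in>Field lam. x) y \<in> tr G"
    then have "x \<in> tr F" "y \<in> tr F"
      using ord_trace by blast+
    then have "x \<in> Field lam" "y \<in> Field lam"
      using trace_subset[OF assms(1)] by auto
    then show "((\<lambda>x\<in>Field lam. x) x, (\<lambda>x\<in>Field lam. x) y) \<in> ord G"
      using xy E(2) \<open>x \<in> tr F\<close> \<open>y \<in> tr F\<close> by simp
  qed simp
qed

lemma permutation_group_tame_group: "permutation_group_on (Field lam) tame_group"
  unfolding permutation_group_on_def
proof (rule group.subgroupI[OF group_BijGroup])
  show "tame_group \<subseteq> carrier (BijGroup (Field lam))"
    by (auto simp: tame_group_def BijGroup_def)
  have "(\<lambda>x\<in>Field lam. x) \<in> tame_group"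
    using tame_id id_Bij by (simp add: tame_group_def)
  then show "tame_group \<noteq> {}"
    by blast
next
  fix g assume g: "g \<in> tame_group"
  then show "inv\<^bsub>BijGroup (Field lam)\<^esub> g \<in> tame_group"
    using tame_inverse[OF g] restrict_inv_into_Bij[OF tame_groupD(1)[OF g]]
    by (simp add: inv_BijGroup[OF tame_groupD(1)[OF g]] tame_group_def)
next
  fix h g assume hg: "h \<in> tame_group" "g \<in> tame_group"
  then have Bij: "h \<in> Bij (Field lam)" "g \<in> Bij (Field lam)"
    using tame_groupD(1) by blast+
  then have "compose (Field lam) h g \<in> tame_group"
    unfolding tame_group_def using tame_compose[OF hg(2,1)] compose_Bij by blast
  then show "h \<otimes>\<^bsub>BijGroup (Field lam)\<^esub> g \<in> tame_group"
    using Bij by (simp add: BijGroup_def)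
qed

text \<open>The pieces are \<open>X\<close>, the rest of \<open>tr A\<close>, and the complement of
  \<open>tr A\<close>, where the map is the identity. On the first two, order passes from
  \<open>F\<close> to \<open>A\<close>, then through \<open>h\<close> or \<open>k\<close>, and from
  \<open>A\<close> to \<open>G\<close>; on the third, \<open>F\<close> and \<open>G\<close> are
  compared directly.\<close>

lemma piecewise_in_tame_group:
  assumes A: "A \<in> \<F>" and XY: "X \<subseteq> tr A" "Y \<subseteq> tr A"
    and h: "bij_betw h X Y" "\<forall>x\<in>X. \<forall>y\<in>X. (x, y) \<in> ord A \<longrightarrow> (h x, h y) \<in> ord A"
    and k: "bij_betw k (tr A - X) (tr A - Y)"
      "\<forall>x\<in>tr A - X. \<forall>y\<in>tr A - X. (x, y) \<in> ord A \<longrightarrow> (k x, k y) \<in> ord A"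
  shows "(\<lambda>x\<in>Field lam. if x \<in> X then h x else if x \<in> tr A then k x else x) \<in> tame_group"
    (is "?g \<in> _")
proof -
  define g where "g = ?g"
  note sub = trace_subset[OF A]
  have gX: "g x = h x" "g x \<in> Y" if "x \<in> X" for x
    using that XY(1) sub h(1) by (auto simp: g_def bij_betw_def)
  have gA: "g x = k x" "g x \<in> tr A - Y" if "x \<in> tr A - X" for x
    using that sub k(1) by (auto simp: g_def bij_betw_def)
  have gR: "g x = x" if "x \<in> Field lam - tr A" for x
    using that XY(1) by (auto simp: g_def)
  have "bij_betw g X Y"
    using h(1) gX(1) bij_betw_cong[of X g h Y] by blast
  moreover have "bij_betw g (tr A - X) (tr A - Y)"
    using k(1) gA(1) bij_betw_cong[of "tr A - X" g k "tr A - Y"] by blast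
  ultimately have "bij_betw g (X \<union> (tr A - X)) (Y \<union> (tr A - Y))"
    by (rule bij_betw_combine) blast
  moreover have "bij_betw g (Field lam - tr A) (Field lam - tr A)"
    using gR bij_betw_cong[of "Field lam - tr A" g id] by auto
  ultimately have "bij_betw g (X \<union> (tr A - X) \<union> (Field lam - tr A)) (Y \<union> (tr A - Y) \<union> (Field lam - tr A))"
    by (rule bij_betw_combine) (use XY in blast)
  moreover have "X \<union> (tr A - X) \<union> (Field lam - tr A) = Field lam"
    "Y \<union> (tr A - Y) \<union> (Field lam - tr A) = Field lam"
    using XY sub by auto
  ultimately have bij: "bij_betw g (Field lam) (Field lam)"
    by simp
  have "tame F G g" if FG: "F \<in> \<F>" "G \<in> \<F>" for F G
  proof -
    obtain E1 where E1: "|E1| <o \<kappa>"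
      "\<forall>x\<in>tr F \<inter> tr A - E1. \<forall>y\<in>tr F \<inter> tr A - E1. (x, y) \<in> ord F \<longleftrightarrow> (x, y) \<in> ord A"
      using ord_agree[OF FG(1) A] by blast
    obtain E2 where E2: "|E2| <o \<kappa>"
      "\<forall>x\<in>tr A \<inter> tr G - E2. \<forall>y\<in>tr A \<inter> tr G - E2. (x, y) \<in> ord A \<longleftrightarrow> (x, y) \<in> ord G"
      using ord_agree[OF A FG(2)] by blast
    obtain E3 where E3: "|E3| <o \<kappa>"
      "\<forall>x\<in>tr F \<inter> tr G - E3. \<forall>y\<in>tr F \<inter> tr G - E3. (x, y) \<in> ord F \<longleftrightarrow> (x, y) \<in> ord G"
      using ord_agree[OF FG] by blast
    let ?E = "E1 \<union> {x \<in> Field lam. g x \<in> E2} \<union> E3"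
    let ?c = "\<lambda>x. if x \<in> X then 0 else if x \<in> tr A then 1 else 2 :: nat"
    show ?thesis
    proof (rule tameI[of ?E ?c])
      have "|{x \<in> Field lam. g x \<in> E2}| \<le>o |E2|"
        using bij by (intro card_of_ordLeqI[of g]) (auto simp: bij_betw_def intro: inj_on_subset)
      then show "|?E| <o \<kappa>"
        using E1(1) E2(1) E3(1) small_Un ordLeq_ordLess_trans by blast
      have "range ?c \<subseteq> {0, 1, 2}"
        by auto
      then show "finite (range ?c)"
        using finite_subset by blast
      fix x y
      assume xy: "x \<notin> ?E" "y \<notin> ?E" "?c x = ?c y" "(x, y) \<in> ord F" "g x \<in> tr G" "g y \<in> tr G"
      have trF: "x \<in> tr F" "y \<in> tr F"
        using ord_trace[OF xy(4)] by auto
      then have in_lam: "x \<in> Field lam" "y \<in> Field lam"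
        using trace_subset[OF FG(1)] by auto
      then have E2': "g x \<notin> E2" "g y \<notin> E2"
        using xy(1,2) by blast+
      consider "x \<in> X" "y \<in> X" | "x \<in> tr A - X" "y \<in> tr A - X"
        | "x \<in> Field lam - tr A" "y \<in> Field lam - tr A"
        using xy(3) in_lam XY(1) by (auto split: if_splits)
      then show "(g x, g y) \<in> ord G"
      proof cases
        case 1
        then have "(x, y) \<in> ord A"
          using E1(2) xy trF XY(1) by blast
        then have "(g x, g y) \<in> ord A"
          using h(2) 1 gX(1) by simp
        moreover have "g x \<in> tr A \<inter> tr G - E2" "g y \<in> tr A \<inter> tr G - E2"
          using gX(2)[OF 1(1)] gX(2)[OF 1(2)] XY(2) E2' xy(5,6) by blast+
        ultimately show ?thesis
          using E2(2) by blast
      next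
        case 2
        then have "(x, y) \<in> ord A"
          using E1(2) xy trF by blast
        then have "(g x, g y) \<in> ord A"
          using k(2) 2 gA(1) by simp
        moreover have "g x \<in> tr A \<inter> tr G - E2" "g y \<in> tr A \<inter> tr G - E2"
          using gA(2)[OF 2(1)] gA(2)[OF 2(2)] E2' xy(5,6) by blast+
        ultimately show ?thesis
          using E2(2) by blast
      next
        case 3
        then show ?thesis
          using E3(2) xy trF gR by auto
      qed
    qed
  qed
  then show ?thesis
    using bij unfolding g_def[symmetric] by (simp add: tame_group_def Bij_def g_def)
qed

section \<open>Homogeneity\<close>

lemma homogeneous_tame_group: "homogeneous_on \<kappa> (Field lam) tame_group"
  unfolding homogeneous_on_def
proof (intro allI impI, elim conjE)
  fix X Y
  assume X: "X \<subseteq> Field lam" "|X| =o \<kappa>" "|Field lam - X| =o |Field lam|"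
    and Y: "Y \<subseteq> Field lam" "|Y| =o \<kappa>" "|Field lam - Y| =o |Field lam|"
  have le: "\<kappa> \<le>o |Field lam - Z|" if "|Field lam - Z| =o |Field lam|" for Z
    using that lam card_of_Field_ordIso ordIso_symmetric ordLeq_ordIso_trans by blast
  \<comment> \<open>\<open>X'\<close> and \<open>Y'\<close> are put into the trace of
    \<open>A\<close> so that the complements of \<open>X\<close> and \<open>Y\<close> in it have
    size \<kappa> and can be matched by an increasing map as well.\<close>
  obtain X' where X': "X' \<subseteq> Field lam - X" "|X'| =o \<kappa>"
    using ordLeq_card_of_subset[OF \<kappa>(1) le[OF X(3)]] by blast
  obtain Y' where Y': "Y' \<subseteq> Field lam - Y" "|Y'| =o \<kappa>"
    using ordLeq_card_of_subset[OF \<kappa>(1) le[OF Y(3)]] by blast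
  have "|(X \<union> Y) \<union> (X' \<union> Y')| \<le>o \<kappa>"
    using X(2) Y(2) X'(2) Y'(2) ordIso_imp_ordLeq
    by (intro card_of_Un_ordLeq_infinite_Field[OF \<kappa>(2) _ _ \<kappa>(1)]) blast+
  then obtain A where A: "A \<in> \<F>" "(X \<union> Y) \<union> (X' \<union> Y') \<subseteq> tr A"
    using coherent_familyD(3)[OF fam] X(1) Y(1) X'(1) Y'(1) by (metis (no_types, lifting) Diff_subset Un_least order_trans)
  have big: "|tr A - Z| =o \<kappa>" if "Z' \<subseteq> tr A - Z" "|Z'| =o \<kappa>" for Z Z'
  proof -
    have "|tr A - Z| \<le>o |tr A|"
      by (rule card_of_mono1) blast
    then have "|tr A - Z| \<le>o \<kappa>"
      using trace_ordLeq[OF \<kappa> coherent_familyD(1)[OF fam A(1)]] ordLeq_transitive by blast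
    moreover have "\<kappa> \<le>o |tr A - Z|"
      using card_of_mono1[OF that(1)] that(2) ordIso_symmetric ordIso_ordLeq_trans by blast
    ultimately show ?thesis
      using ordIso_iff_ordLeq by blast
  qed
  have XA: "X \<subseteq> tr A" and YA: "Y \<subseteq> tr A"
    using A(2) by auto
  obtain h where h: "bij_betw h X Y" "\<forall>x\<in>X. \<forall>y\<in>X. (x, y) \<in> ord A \<longrightarrow> (h x, h y) \<in> ord A"
    using order_matching[OF A(1) XA X(2) YA Y(2)] by blast
  have "|tr A - X| =o \<kappa>" "|tr A - Y| =o \<kappa>"
    using big[OF _ X'(2)] big[OF _ Y'(2)] X'(1) Y'(1) A(2) by blast+
  then obtain k where k: "bij_betw k (tr A - X) (tr A - Y)"
      "\<forall>x\<in>tr A - X. \<forall>y\<in>tr A - X. (x, y) \<in> ord A \<longrightarrow> (k x, k y) \<in> ord A"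
    using order_matching[OF A(1) Diff_subset _ Diff_subset] by blast
  let ?g = "\<lambda>x\<in>Field lam. if x \<in> X then h x else if x \<in> tr A then k x else x"
  have "?g ` X = h ` X"
    using X(1) by (intro image_cong) auto
  also have "\<dots> = Y"
    using h(1) by (simp add: bij_betw_def)
  finally show "\<exists>g\<in>tame_group. g ` X = Y"
    using piecewise_in_tame_group[OF A(1) XA YA h k] by blast
qed

section \<open>Failure of transitivity\<close>

lemma large_coinfinite_subset: "\<exists>X\<subseteq>Field lam. |X| =o \<kappa> \<and> |Field lam - X| =o |Field lam|"
proof -
  let ?L = "Field lam"
  have inf: "infinite ?L"
    using card_of_ordLeq_infinite[OF card_of_mono2[OF lam(2)] \<kappa>(2)] .
  \<comment> \<open>The field of \<open>lam\<close> splits into two copies of itself.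
    \<open>X\<close> is taken inside the left copy, and the right copy keeps the complement
    large.\<close>
  obtain \<phi> where \<phi>: "bij_betw \<phi> (?L <+> ?L) ?L"
    using card_of_Plus_infinite1[OF inf card_of_mono1[OF subset_refl]] card_of_ordIso ordIso_symmetric by metis
  have inj: "inj_on \<phi> (?L <+> ?L)" and im: "\<phi> ` (?L <+> ?L) = ?L"
    using \<phi> by (auto simp: bij_betw_def)
  have "|?L| \<le>o |\<phi> ` Inl ` ?L|" "|?L| \<le>o |\<phi> ` Inr ` ?L|"
    using inj by (intro card_of_ordLeqI[of "\<phi> \<circ> Inl"] card_of_ordLeqI[of "\<phi> \<circ> Inr"]; auto simp: inj_on_def)+
  moreover have "\<kappa> \<le>o |?L|"
    using lam card_of_Field_ordIso ordIso_symmetric ordLeq_ordIso_trans by blast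
  ultimately obtain X where X: "X \<subseteq> \<phi> ` Inl ` ?L" "|X| =o \<kappa>"
    using ordLeq_card_of_subset[OF \<kappa>(1)] ordLeq_transitive by metis
  have "\<phi> ` Inr ` ?L \<subseteq> ?L - X"
  proof -
    have sub: "Inl ` ?L \<subseteq> ?L <+> ?L" "Inr ` ?L \<subseteq> ?L <+> ?L"
      by auto
    have "\<phi> ` Inl ` ?L \<inter> \<phi> ` Inr ` ?L = \<phi> ` (Inl ` ?L \<inter> Inr ` ?L)"
      using inj_on_image_Int[OF inj sub] by simp
    also have "Inl ` ?L \<inter> Inr ` ?L = {}"
      by auto
    finally have "\<phi> ` Inl ` ?L \<inter> \<phi> ` Inr ` ?L = {}"
      by simp
    moreover have "\<phi> ` Inr ` ?L \<subseteq> ?L"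
      using image_mono[OF sub(2), of \<phi>] im by simp
    ultimately show ?thesis
      using X(1) by fast
  qed
  then have "|?L| \<le>o |?L - X|"
    by (intro ordLeq_transitive[OF \<open>|?L| \<le>o |\<phi> ` Inr ` ?L|\<close> card_of_mono1])
  moreover have "|?L - X| \<le>o |?L|"
    by (rule card_of_mono1) blast
  moreover have "X \<subseteq> ?L"
    using X(1) im by auto
  ultimately show ?thesis
    using X(2) ordIso_iff_ordLeq by blast
qed

text \<open>The product of \<kappa> with countable sets still has size \<kappa>, so \<open>X\<close>
  has room for all the blocks. There are \<kappa> of each size, so that fewer than \<kappa>
  exceptional points cannot meet them all.\<close>

lemma finite_blocks:
  assumes "|X| =o \<kappa>"
  shows "\<exists>Z (b :: 'a \<Rightarrow> 'k \<times> nat). Z \<subseteq> X \<and> b ` Z \<subseteq> Field \<kappa> \<times> UNIV \<and>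
    (\<forall>\<xi>\<in>Field \<kappa>. \<forall>m. finite {x \<in> Z. b x = (\<xi>, m)} \<and> card {x \<in> Z. b x = (\<xi>, m)} = Suc m)"
proof -
  have "|UNIV :: (nat \<times> nat) set| \<le>o |UNIV :: nat set|"
    by (rule card_of_ordLeqI[of prod_encode]) (simp_all add: inj_prod_encode)
  also have "|UNIV :: nat set| \<le>o |Field \<kappa>|"
    using \<kappa>(2) infinite_iff_card_of_nat by blast
  finally have nat: "|UNIV :: (nat \<times> nat) set| \<le>o |Field \<kappa>|" .
  have "|Field \<kappa> \<times> (UNIV :: (nat \<times> nat) set)| =o |Field \<kappa>|"
    using card_of_Times_infinite[OF \<kappa>(2) _ nat] by blast
  also have "|Field \<kappa>| =o \<kappa>"
    using card_of_Field_ordIso[OF \<kappa>(1)] .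
  also have "\<kappa> =o |X|"
    using assms ordIso_symmetric by blast
  finally obtain \<psi> where "bij_betw \<psi> (Field \<kappa> \<times> (UNIV :: (nat \<times> nat) set)) X"
    using card_of_ordIso by metis
  then have inj: "inj_on \<psi> (Field \<kappa> \<times> (UNIV :: (nat \<times> nat) set))"
    and im: "\<psi> ` (Field \<kappa> \<times> UNIV) = X"
    by (auto simp: bij_betw_def)
  \<comment> \<open>The condition \<open>k \<le> m\<close> leaves \<open>Suc m\<close> values of
    \<open>k\<close>, so the block with index \<open>m\<close> has more points than \<open>m\<close>
    colours.\<close>
  define T where "T = {(\<xi>, m, k) | \<xi> m k. \<xi> \<in> Field \<kappa> \<and> k \<le> (m :: nat)}"
  have T: "T \<subseteq> Field \<kappa> \<times> UNIV"
    by (auto simp: T_def)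
  have injT: "inj_on \<psi> T"
    using inj T by (rule inj_on_subset)
  define b where "b x = (let (\<xi>, m, k) = inv_into T \<psi> x in (\<xi>, m))" for x
  have b: "b (\<psi> (\<xi>, m, k)) = (\<xi>, m)" if "(\<xi>, m, k) \<in> T" for \<xi> m k
    unfolding b_def using inv_into_f_f[OF injT that] by simp
  have "finite {x \<in> \<psi> ` T. b x = (\<xi>, m)} \<and> card {x \<in> \<psi> ` T. b x = (\<xi>, m)} = Suc m"
    if \<xi>: "\<xi> \<in> Field \<kappa>" for \<xi> m
  proof -
    have "{x \<in> \<psi> ` T. b x = (\<xi>, m)} = \<psi> ` (\<lambda>k. (\<xi>, m, k)) ` {..m}"
      using b \<xi> by (auto simp: T_def)
    moreover have "inj_on (\<psi> \<circ> (\<lambda>k. (\<xi>, m, k))) {..m}"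
      using \<xi> by (intro comp_inj_on inj_on_subset[OF injT]) (auto simp: T_def inj_on_def)
    ultimately show ?thesis
      using card_image[of "\<psi> \<circ> (\<lambda>k. (\<xi>, m, k))" "{..m}"] by (simp add: image_comp)
  qed
  moreover have "\<psi> ` T \<subseteq> X"
    using T im by blast
  moreover have "b ` \<psi> ` T \<subseteq> Field \<kappa> \<times> UNIV"
    using b by (auto simp: T_def)
  ultimately show ?thesis
    by blast
qed

text \<open>
  Reversing every block of such a partition defeats all tame permutations: some block avoids the
  exceptional set and has more elements than there are colours.
\<close>

lemma not_transitive_tame_group: "\<not> transitive_on \<kappa> (Field lam) tame_group"
proof
  assume trans: "transitive_on \<kappa> (Field lam) tame_group"
  let ?L = "Field lam"
  obtain X where X: "X \<subseteq> ?L" "|X| =o \<kappa>" "|?L - X| =o |?L|"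
    using large_coinfinite_subset by blast
  obtain F where F: "F \<in> \<F>" "X \<subseteq> tr F"
    using coherent_familyD(3)[OF fam X(1) ordIso_imp_ordLeq[OF X(2)]] by blast
  obtain Z and b :: "'a \<Rightarrow> 'k \<times> nat" where Z: "Z \<subseteq> X" and bZ: "b ` Z \<subseteq> Field \<kappa> \<times> UNIV"
    and blocks': "\<forall>\<xi>\<in>Field \<kappa>. \<forall>m. finite {x \<in> Z. b x = (\<xi>, m)} \<and> card {x \<in> Z. b x = (\<xi>, m)} = Suc m"
    using finite_blocks[OF X(2)] by (elim exE conjE)
  define S where "S i = {x \<in> Z. b x = i}" for i
  have blocks: "finite (S (\<xi>, m))" "card (S (\<xi>, m)) = Suc m" if "\<xi> \<in> Field \<kappa>" for \<xi> m
    using blocks' that by (simp_all add: S_def)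
  have ZF: "Z \<subseteq> tr F"
    using Z F(2) by blast
  have "\<exists>p. bij_betw p (S i) (S i) \<and> (\<forall>x y. (x, y) \<in> Restr (ord F) (S i) \<longrightarrow> (p y, p x) \<in> Restr (ord F) (S i))"
    if "i \<in> Field \<kappa> \<times> UNIV" for i
  proof (rule finite_order_reversal)
    show "finite (S i)"
      using blocks(1) that by auto
    show "well_order_on (S i) (Restr (ord F) (S i))"
      using ZF by (intro well_order_Restr_ord[OF F(1)]) (auto simp: S_def)
  qed
  then obtain p where p: "\<And>i. i \<in> Field \<kappa> \<times> UNIV \<Longrightarrow> bij_betw (p i) (S i) (S i)"
    and rev: "\<And>i x y. i \<in> Field \<kappa> \<times> UNIV \<Longrightarrow> (x, y) \<in> Restr (ord F) (S i) \<Longrightarrow> (p i y, p i x) \<in> Restr (ord F) (S i)"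
    by metis
  \<comment> \<open>Each block is reversed with respect to \<open>ord F\<close>. As
    \<open>p i\<close> stays inside its block, \<open>f\<close> is injective.\<close>
  define f where "f x = (if x \<in> Z then Some (p (b x) x) else None)" for x
  have pS: "p (b x) x \<in> S (b x)" if "x \<in> Z" for x
    using p[of "b x"] bZ that unfolding bij_betw_def S_def by blast
  have dom: "dom f = Z"
    by (auto simp: f_def dom_def)
  have ran: "ran f \<subseteq> Z"
    using pS by (auto simp: f_def ran_def S_def)
  have "inj_on f (dom f)"
    unfolding dom
  proof (rule inj_onI)
    fix x y assume xy: "x \<in> Z" "y \<in> Z" "f x = f y"
    then have eq: "p (b x) x = p (b y) y"
      by (simp add: f_def)
    then have "b x = b y"
      using pS[OF xy(1)] pS[OF xy(2)] by (simp add: S_def)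
    then show "x = y"
      using eq p[of "b x"] bZ xy by (auto simp: bij_betw_def S_def inj_on_def)
  qed
  moreover have "dom f \<union> ran f \<subseteq> ?L"
    using dom ran Z X(1) by blast
  moreover have "|dom f \<union> ran f| \<le>o \<kappa>"
  proof -
    have "|dom f \<union> ran f| \<le>o |X|"
      using dom ran Z by (intro card_of_mono1) blast
    then show ?thesis
      using X(2) ordLeq_ordIso_trans by blast
  qed
  moreover have co: "|?L - U| =o |?L|" if "U \<subseteq> X" for U
  proof -
    have "|?L - U| \<le>o |?L|" "|?L - X| \<le>o |?L - U|"
      using that by (auto intro: card_of_mono1)
    then show ?thesis
      using X(3) ordIso_iff_ordLeq ordIso_symmetric ordIso_ordLeq_trans by blast
  qed
  moreover have "|?L - dom f| =o |?L|" "|?L - ran f| =o |?L|"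
    using dom ran Z by (auto intro: co)
  ultimately obtain g where g: "g \<in> tame_group" "f \<subseteq>\<^sub>m (\<lambda>x. Some (g x))"
    using trans unfolding transitive_on_def by blast
  have gp: "g x = p (b x) x" if "x \<in> Z" for x
    using g(2) that dom unfolding map_le_def by (auto simp: f_def)
  obtain E and c :: "'a \<Rightarrow> nat" where E: "|E| <o \<kappa>" "finite (range c)"
    "\<And>x y. \<lbrakk>x \<notin> E; y \<notin> E; c x = c y; (x, y) \<in> ord F; g x \<in> tr F; g y \<in> tr F\<rbrakk>
      \<Longrightarrow> (g x, g y) \<in> ord F"
    using tame_groupD(3)[OF g(1) F(1) F(1)] by (rule tameE) blast
  let ?m = "card (range c)"
  \<comment> \<open>Otherwise an exceptional point chosen from each block of this size would inject
    \<open>Field \<kappa>\<close> into \<open>E\<close>.\<close>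
  have "\<exists>\<xi>\<in>Field \<kappa>. S (\<xi>, ?m) \<inter> E = {}"
  proof (rule ccontr)
    assume "\<not> ?thesis"
    then have "\<forall>\<xi>\<in>Field \<kappa>. \<exists>x. x \<in> S (\<xi>, ?m) \<inter> E"
      by blast
    then obtain e where e: "\<And>\<xi>. \<xi> \<in> Field \<kappa> \<Longrightarrow> e \<xi> \<in> S (\<xi>, ?m) \<inter> E"
      by metis
    have "inj_on e (Field \<kappa>)"
    proof (rule inj_onI)
      fix \<xi> \<zeta> assume "\<xi> \<in> Field \<kappa>" "\<zeta> \<in> Field \<kappa>" "e \<xi> = e \<zeta>"
      then show "\<xi> = \<zeta>"
        using e[of \<xi>] e[of \<zeta>] by (auto simp: S_def)
    qed
    then have "|Field \<kappa>| \<le>o |E|"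
      using e by (intro card_of_ordLeqI) auto
    then have "\<kappa> \<le>o |E|"
      using card_of_Field_ordIso[OF \<kappa>(1)] ordIso_symmetric ordIso_ordLeq_trans by blast
    then show False
      using E(1) not_ordLess_ordLeq by blast
  qed
  then obtain \<xi> where \<xi>: "\<xi> \<in> Field \<kappa>" "S (\<xi>, ?m) \<inter> E = {}"
    by blast
  let ?i = "(\<xi>, ?m)"
  \<comment> \<open>The block has \<open>Suc ?m\<close> points, one more than there are
    colours.\<close>
  have "card (c ` S ?i) < card (S ?i)"
    using blocks(2)[OF \<xi>(1), of ?m] card_mono[OF E(2), of "c ` S ?i"] by force
  then obtain x y where xy: "x \<in> S ?i" "y \<in> S ?i" "x \<noteq> y" "c x = c y"
    using pigeonhole unfolding inj_on_def by blast
  \<comment> \<open>\<open>f\<close> reverses the pair and tameness preserves it, so by antisymmetry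
    its two points would have the same image.\<close>
  have no_pair: False if xy: "x \<in> S ?i" "y \<in> S ?i" "x \<noteq> y" "c x = c y" "(x, y) \<in> ord F" for x y
  proof -
    have i: "?i \<in> Field \<kappa> \<times> UNIV"
      using \<xi>(1) by blast
    have gxy: "g x = p ?i x" "g y = p ?i y"
      using gp xy(1,2) by (auto simp: S_def)
    have "(p ?i y, p ?i x) \<in> Restr (ord F) (S ?i)"
      using rev[OF i] xy by blast
    then have rev': "(g y, g x) \<in> ord F"
      using gxy by simp
    moreover have "(g x, g y) \<in> ord F"
      using xy \<xi>(2) ord_trace[OF rev'] by (intro E(3)) auto
    ultimately have "p ?i x = p ?i y"
      using ord_antisym[OF F(1)] gxy by metis
    then show False
      using inj_onD[OF bij_betw_imp_inj_on[OF p[OF i]]] xy by blast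
  qed
  have "x \<in> tr F" "y \<in> tr F"
    using xy(1,2) ZF by (auto simp: S_def)
  then have "(x, y) \<in> ord F \<or> (y, x) \<in> ord F"
    using ord_total[OF F(1)] by blast
  then show False
    using no_pair[OF xy] no_pair[OF xy(2,1) xy(3)[symmetric] xy(4)[symmetric]] by blast
qed

end

theorem corollary3p12:
  fixes \<kappa> :: "'k rel" and lam :: "'a rel" and n :: nat
  assumes "Cinfinite \<kappa>"
    and "\<kappa> ^c natLeq =o \<kappa>"
    and "is_nth_cardSuc n \<kappa> lam"
    and "\<And>\<nu> :: 'a rel. Card_order \<nu> \<Longrightarrow> \<kappa> \<le>o \<nu> \<Longrightarrow> \<nu> <o lam \<Longrightarrow> jensen_square \<nu>"
  shows "\<exists>G. permutation_group_on (Field lam) G \<and>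
             homogeneous_on \<kappa> (Field lam) G \<and>
             \<not> transitive_on \<kappa> (Field lam) G"
proof -
  have \<kappa>: "Card_order \<kappa>" "infinite (Field \<kappa>)"
    using assms(1) by (auto simp: cinfinite_def)
  \<comment> \<open>Cantor's theorem yields \<omega> < 2^\<omega> \<le> \<kappa>^\<omega> =
    \<kappa>.\<close>
  have "natLeq <o ctwo ^c natLeq"
    by (rule ordLess_ctwo_cexp[OF natLeq_Card_order])
  also have "ctwo ^c natLeq \<le>o \<kappa> ^c natLeq"
    using ctwo_ordLeq_Cinfinite[OF assms(1)] by (rule cexp_mono1[OF _ natLeq_Card_order])
  also have "\<kappa> ^c natLeq =o \<kappa>"
    by fact
  finally have uncountable: "natLeq <o \<kappa>" .
  obtain \<F> where "coherent_family \<kappa> (Field lam) \<F>"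
    using coherent_family_exists[OF \<kappa>(1) uncountable assms(3,4)] by blast
  then interpret coherent_orders \<kappa> lam \<F>
    using \<kappa> is_nth_cardSuc_Card_order[OF \<kappa>(1) assms(3)] by unfold_locales auto
  show ?thesis
    using permutation_group_tame_group homogeneous_tame_group not_transitive_tame_group by blast
qed

end
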